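(* Let $N\ge 2$ be an integer, let $r\ge 1$ be real, and let $K\subset\mathbb{R}^2$ be a centrally symmetric convex body. Let $Q\subset\mathbb{R}^2$ be a square centered at the origin with $|Q|=|K|$. Then $$\mathbb{E}\,\bigl|([K]_N)^{\circ}\bigr|^{-r}\;\le\;\mathbb{E}\,\bigl|([Q]_N)^{\circ}\bigr|^{-r}.$$
   Context: A convex body in $\mathbb{R}^2$ is a compact convex set with non-empty interior; it is centrally symmetric if $K=-K$. $|\cdot|$ denotes Lebesgue measure on $\mathbb{R}^2$. For a set $L\subset\mathbb{R}^2$, the polar is $L^{\circ}=\{\omega\in\mathbb{R}^2:\langle\omega,x\rangle\le 1\ \ \forall x\in L\}$. For a convex body $K\subset\mathbb{R}^2$, $[K]_N=\operatorname{conv}\{\pm X_1,\dots,\pm X_N\}$, where $X_1,\dots,X_N$ are independent random vectors uniformly distributed in $K$ (and similarly $[Q]_N$ is built from independent random vectors uniformly distributed in $Q$). Convention: $|L^\circ|^{-r}=0$ if $|L^\circ|=\infty$ (this concerns only a probability-zero event). *)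

theory Defs
  imports "HOL-Probability.Probability"
begin

definition convex_body :: "'a::euclidean_space set \<Rightarrow> bool" where
  "convex_body K \<longleftrightarrow> compact K \<and> convex K \<and> interior K \<noteq> {}"

definition centrally_symmetric :: "'a::euclidean_space set \<Rightarrow> bool" where
  "centrally_symmetric K \<longleftrightarrow> K = uminus ` K"

definition polar :: "'a::euclidean_space set \<Rightarrow> 'a set" where
  "polar L = {w. \<forall>x\<in>L. w \<bullet> x \<le> 1}"

text \<open>The sides need not be parallel to the coordinate axes.\<close>

definition centered_square :: "(real^2) set \<Rightarrow> bool" where
  "centered_square Q \<longleftrightarrow>
     (\<exists>a (f :: real^2 \<Rightarrow> real^2). a > 0 \<and> orthogonal_transformation f \<and>
            Q = f ` cbox (vector [-a, -a]) (vector [a, a]))"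

definition symmetric_hull :: "nat \<Rightarrow> (nat \<Rightarrow> 'a::euclidean_space) \<Rightarrow> 'a set" where
  "symmetric_hull N x = convex hull (\<Union>i\<in>{1..N}. {x i, - x i})"

text \<open>Measurability of the \<open>X i\<close> is part of \<^const>\<open>prob_space.indep_vars\<close>.\<close>

definition iid_uniform ::
  "'w measure \<Rightarrow> nat \<Rightarrow> (nat \<Rightarrow> 'w \<Rightarrow> 'a::euclidean_space) \<Rightarrow> 'a set \<Rightarrow> bool" where
  "iid_uniform M N X K \<longleftrightarrow>
     prob_space M \<and>
     prob_space.indep_vars M (\<lambda>_. borel) X {1..N} \<and>
     (\<forall>i\<in>{1..N}. distr M borel (X i) = uniform_measure lborel K)"

text \<open>
  \<open>|L|\<close> to the power \<open>-r\<close>, with value \<open>0\<close> if \<open>|L|\<close> is infinite.  For \<open>|L| = 0\<close> the convention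
  \<open>0 powr -r = 0\<close> of the library would apply, but the polar of a bounded set contains a ball
  around the origin, so this case does not arise for polars of convex hulls of finite sets.
\<close>

definition volume_powr_neg :: "real \<Rightarrow> 'a::euclidean_space set \<Rightarrow> real" where
  "volume_powr_neg r L =
     (if emeasure lborel L = \<infinity> then 0 else measure lborel L powr (- r))"

text \<open>
  The expectation of \<open>|([K]_N)\<degree>|\<close> to the power \<open>-r\<close>, where \<open>[K]_N\<close> is the symmetric hull of
  \<open>X 1, \<dots>, X N\<close>.  The integrand is nonnegative, so the expectation is taken in \<open>[0, \<infinity>]\<close>.
\<close>

definition expected_polar_power ::
  "'w measure \<Rightarrow> nat \<Rightarrow> real \<Rightarrow> (nat \<Rightarrow> 'w \<Rightarrow> 'a::euclidean_space) \<Rightarrow> ennreal" where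
  "expected_polar_power M N r X =
     (\<integral>\<^sup>+ \<omega>. ennreal (volume_powr_neg r (polar (symmetric_hull N (\<lambda>i. X i \<omega>)))) \<partial>M)"

end

theory Submission
  imports Defs
begin

text \<open>
  Call a map \<open>(x, y) \<mapsto> (x + t * \<beta> y, y)\<close> with odd \<open>\<beta>\<close> a shadow movement.  For fixed points
  \<open>x\<^sub>1, \<dots>, x\<^sub>N\<close> moved in this way, the reciprocal of the area of the polar of their symmetric
  hull is a convex function of \<open>t\<close> (a Brunn-Minkowski argument on the vertical slices), hence so
  is its \<open>r\<close>-th power, and so is the expectation, because the movement preserves area.

  If \<open>p\<close> and \<open>q\<close> are vertices of a symmetric polygon and some vertex lies beyond the line \<open>p q\<close>,
  the movement that shears the caps beyond \<open>\<plusminus> p q\<close> parallel to \<open>p - q\<close> and fixes the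
  rest keeps the polygon convex until, in either direction of time, a vertex disappears.  By convexity
  the expectation does not decrease at one of the two ends, so induction on the number of vertices
  reduces polygons to parallelograms, which are linear images of the square; normalised by the
  area, the expectation is invariant under linear maps.  Inscribed polygons exhaust a general body.
\<close>

subsection \<open>Convex hulls and extreme points\<close>

text \<open>The convexity in \<open>t\<close> concerns a fixed sample, so only the two end positions
  of the polygon have to be hulls again. Since the movement is merely piecewise affine, this can
  fail: a moved polygon is convex only as long as every segment from a vertex below the chord to one
  above it crosses the height of the chord between its end points. The crossings travel at positive
  speed, and the first to reach an end point of the chord stops the movement; that end point then
  lies between two other moved vertices. Polygons are given by finite generating sets, not by
  ordered vertex lists, and the cardinality of these sets drives the induction. For the area, the
  widths of the two polars are unrelated; slices are compared after rescaling the widths, and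
  Cauchy-Schwarz then removes the widths. What remains is the weighted harmonic mean of the areas,
  which is why the reciprocal is convex.\<close>

lemma convex_closed_segmentD:
  "convex C \<Longrightarrow> a \<in> C \<Longrightarrow> b \<in> C \<Longrightarrow> w \<in> closed_segment a b \<Longrightarrow> w \<in> C"
  using closed_segment_subset by blast

text \<open>Strictness at \<open>b\<close> makes \<open>f b - f a\<close> positive, so the level set
  cuts the segment at a definite parameter \<open>s < 1\<close>. The last two conclusions allow
  convexity on one side of the level set to be used on each part separately.\<close>

lemma segment_crossing:
  fixes a b w :: "'a::real_vector" and f :: "'a \<Rightarrow> real"
  assumes "linear f" "f a \<le> c" "c < f b"
    and w: "w \<in> closed_segment a b"
  obtains p where "p \<in> closed_segment a b" "f p = c"
    "f w \<le> c \<Longrightarrow> w \<in> closed_segment a p" "f w \<ge> c \<Longrightarrow> w \<in> closed_segment p b"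
proof -
  interpret f: linear f by fact
  obtain u where u: "0 \<le> u" "u \<le> 1" "w = (1 - u) *\<^sub>R a + u *\<^sub>R b"
    using w by (auto simp: in_segment)
  define s where "s = (c - f a) / (f b - f a)"
  have s: "0 \<le> s" "s < 1" and sc: "s * (f b - f a) = c - f a"
    using assms(2,3) by (auto simp: s_def divide_simps)
  define p where "p = (1 - s) *\<^sub>R a + s *\<^sub>R b"
  have fw: "f w = f a + u * (f b - f a)"
    unfolding u(3) f.add f.scale by (simp add: algebra_simps)
  show ?thesis
  proof
    show "p \<in> closed_segment a b" using s by (auto simp: in_segment p_def)
    show "f p = c" using sc unfolding p_def f.add f.scale by (simp add: algebra_simps)
    show "w \<in> closed_segment a p" if "f w \<le> c"
    proof (cases "s = 0")
      case True
      then have "u * (f b - f a) \<le> 0" using fw that sc by simp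
      then have "u = 0" using u(1) assms(2,3)
        by (smt (verit) mult_pos_pos)
      then show ?thesis by (simp add: u)
    next
      case False
      have "u * (f b - f a) \<le> s * (f b - f a)" using fw that sc by simp
      then have "u \<le> s" using assms(2,3) by simp
      define k where "k = u / s"
      have k: "0 \<le> k" "k \<le> 1" "k * s = u"
        using \<open>u \<le> s\<close> s u False by (auto simp: k_def divide_simps)
      have "w = (1 - k) *\<^sub>R a + k *\<^sub>R p"
        unfolding p_def u(3) k(3)[symmetric] by (simp add: algebra_simps)
      then show ?thesis using k by (auto simp: in_segment)
    qed
    show "w \<in> closed_segment p b" if "f w \<ge> c"
    proof -
      have "s * (f b - f a) \<le> u * (f b - f a)" using fw that sc by simp
      then have "s \<le> u" using assms(2,3) by simp
      define k where "k = (u - s) / (1 - s)"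
      have k: "0 \<le> k" "k \<le> 1" "k * (1 - s) = u - s"
        using \<open>s \<le> u\<close> s u by (auto simp: k_def)
      have "1 - k - (1 - k) * s = 1 - u" "(1 - k) * s + k = u"
        using k(3) by (auto simp: algebra_simps)
      then have "w = (1 - k - (1 - k) * s) *\<^sub>R a + ((1 - k) * s + k) *\<^sub>R b"
        by (simp only: u(3))
      also have "\<dots> = (1 - k) *\<^sub>R p + k *\<^sub>R b"
        unfolding p_def by (simp add: algebra_simps)
      finally have "w = (1 - k) *\<^sub>R p + k *\<^sub>R b" .
      then show ?thesis using k by (auto simp: in_segment)
    qed
  qed
qed

text \<open>The points that satisfy the claim form a convex set containing \<open>V\<close>: a
  segment that leaves the half-space does so through the level set, where \<open>cut\<close>
  applies. The hypothesis \<open>cut\<close> says that the cut creates no new vertices.\<close>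

lemma convex_hull_halfspace:
  fixes f :: "'a::real_vector \<Rightarrow> real"
  assumes f: "linear f"
    and z: "z \<in> convex hull V" "f z \<le> c"
    and cut: "\<And>x. x \<in> convex hull V \<Longrightarrow> f x = c \<Longrightarrow> x \<in> convex hull {v \<in> V. f v \<le> c}"
  shows "z \<in> convex hull {v \<in> V. f v \<le> c}"
proof -
  interpret f: linear f by fact
  define W where "W = convex hull {v \<in> V. f v \<le> c}"
  define S where "S = {z \<in> convex hull V. f z \<le> c \<longrightarrow> z \<in> W}"
  have S1: "w \<in> W" if "a \<in> S" "b \<in> S" and wab: "w \<in> closed_segment a b" and fw: "f w \<le> c" and fa: "f a \<le> c" for a b w
  proof (cases "f b \<le> c")
    case True
    then have "a \<in> W" "b \<in> W" using that by (auto simp: S_def)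
    then show ?thesis using wab unfolding W_def
      by (blast intro: convex_closed_segmentD[OF convex_convex_hull])
  next
    case False
    then have "c < f b" by simp
    from segment_crossing[OF f fa this wab] fw
    obtain p where p: "p \<in> closed_segment a b" "f p = c" "w \<in> closed_segment a p"
      by blast
    have "p \<in> convex hull V" using p(1) that(1,2) unfolding S_def
      by (blast intro: convex_closed_segmentD[OF convex_convex_hull])
    then have "p \<in> W" using cut p(2) by (auto simp: W_def)
    moreover have "a \<in> W" using that by (auto simp: S_def)
    ultimately show ?thesis using p(3) unfolding W_def
      by (blast intro: convex_closed_segmentD[OF convex_convex_hull])
  qed
  have "convex S"
    unfolding convex_contains_segment
  proof (intro ballI subsetI)
    fix a b w assume ab: "a \<in> S" "b \<in> S" "w \<in> closed_segment a b"
    have "w \<in> convex hull V" using ab unfolding S_def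
      by (blast intro: convex_closed_segmentD[OF convex_convex_hull])
    moreover have "w \<in> W" if le: "f w \<le> c"
    proof -
      obtain u where u: "0 \<le> u" "u \<le> 1" "w = (1 - u) *\<^sub>R a + u *\<^sub>R b"
        using ab by (auto simp: in_segment)
      have "f w = (1 - u) * f a + u * f b" by (simp add: u f.add f.scale)
      then have "\<not> (f a > c \<and> f b > c)"
        using le u convex_bound_lt[of "- f a" "- c" "- f b" "1 - u" u] by auto
      then show ?thesis
        using S1[OF ab le] S1[OF ab(2,1) _ le] ab(3) by (force simp: closed_segment_commute)
    qed
    ultimately show "w \<in> S" by (simp add: S_def)
  qed
  moreover have "V \<subseteq> S" by (auto simp: S_def W_def hull_inc)
  ultimately have "convex hull V \<subseteq> S" by (rule hull_minimal[rotated])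
  then show ?thesis using z by (auto simp: S_def W_def)
qed

text \<open>A segment with ends on both sides is split at its crossing point, which
  \<open>cross\<close> places in \<open>S\<close>, and each piece lies in one of the two convex
  parts. This is the convexity test for images under a piecewise affine map.\<close>

lemma convex_glue:
  fixes f :: "'a::real_vector \<Rightarrow> real"
  assumes f: "linear f"
    and lo: "convex (S \<inter> {x. f x \<le> c})" and hi: "convex (S \<inter> {x. c \<le> f x})"
    and cross: "\<And>a b p. a \<in> S \<Longrightarrow> b \<in> S \<Longrightarrow> f a < c \<Longrightarrow> c < f b \<Longrightarrow>
      p \<in> closed_segment a b \<Longrightarrow> f p = c \<Longrightarrow> p \<in> S"
  shows "convex S"
proof -
  have main: "w \<in> S" if ab: "a \<in> S" "b \<in> S" "w \<in> closed_segment a b" and le: "f a \<le> f b" for a b w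
  proof -
    consider "f b \<le> c" | "c \<le> f a" | "f a < c" "c < f b" by linarith
    then show ?thesis
    proof cases
      case 1
      then show ?thesis using lo ab le unfolding convex_contains_segment by fastforce
    next
      case 2
      then show ?thesis using hi ab le unfolding convex_contains_segment by fastforce
    next
      case 3
      obtain p where p: "p \<in> closed_segment a b" "f p = c"
        "f w \<le> c \<Longrightarrow> w \<in> closed_segment a p" "f w \<ge> c \<Longrightarrow> w \<in> closed_segment p b"
        using segment_crossing[OF f less_imp_le[OF 3(1)] 3(2) ab(3)] by blast
      have "p \<in> S" using cross ab 3 p by blast
      show ?thesis
      proof (cases "f w \<le> c")
        case True
        show ?thesis
          using convex_closed_segmentD[OF lo _ _ p(3)[OF True]] ab(1) 3(1) p(2) \<open>p \<in> S\<close> by simp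
      next
        case False
        show ?thesis
          using convex_closed_segmentD[OF hi _ _ p(4)] False ab(2) 3(2) p(2) \<open>p \<in> S\<close> by simp
      qed
    qed
  qed
  show ?thesis
    unfolding convex_contains_segment
    using main by (metis closed_segment_commute linear subsetI)
qed

lemma extreme_point_of_linear_inj:
  fixes f :: "'a::euclidean_space \<Rightarrow> 'b::euclidean_space"
  assumes f: "linear f" "inj f" and x: "x extreme_point_of S"
  shows "f x extreme_point_of (f ` S)"
  unfolding extreme_point_of_def
proof (intro conjI ballI)
  show "f x \<in> f ` S" using x by (simp add: extreme_point_of_def)
  fix a b assume "a \<in> f ` S" "b \<in> f ` S"
  then obtain a' b' where ab: "a = f a'" "b = f b'" "a' \<in> S" "b' \<in> S" by auto
  then have "x \<notin> open_segment a' b'" using x by (simp add: extreme_point_of_def)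
  then show "f x \<notin> open_segment a b"
    unfolding ab open_segment_linear_image[OF f] using f(2) by (simp add: inj_image_mem_iff)
qed

lemma extreme_point_of_uminus:
  fixes S :: "'a::euclidean_space set"
  assumes "\<And>z. z \<in> S \<Longrightarrow> - z \<in> S" and x: "x extreme_point_of S"
  shows "- x extreme_point_of S"
proof -
  have "linear (uminus :: 'a \<Rightarrow> _)" "inj (uminus :: 'a \<Rightarrow> _)"
    by (auto intro!: linearI injI)
  from extreme_point_of_linear_inj[OF this x]
  have "- x extreme_point_of (uminus ` S)" .
  moreover have "uminus ` S = S" using assms(1) by force
  ultimately show ?thesis by simp
qed

subsection \<open>Shearing the caps of a symmetric polygon\<close>

text \<open>The kinks sit at the heights of the chord and of its opposite. Oddness keeps the moved
  polygon centrally symmetric, and continuity makes the three affine pieces of the movement fit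
  together.\<close>

definition cap_speed :: "real \<Rightarrow> real" where
  "cap_speed s = max (s - 1) 0 - max (- s - 1) 0"

definition cap_shear :: "real \<Rightarrow> real^2 \<Rightarrow> real^2" where
  "cap_shear t z = vector [z $ 1 + t * cap_speed (z $ 2), z $ 2]"

lemma cap_speed_cases:
  "s \<ge> 1 \<Longrightarrow> cap_speed s = s - 1" "s \<le> -1 \<Longrightarrow> cap_speed s = s + 1"
  "-1 \<le> s \<Longrightarrow> s \<le> 1 \<Longrightarrow> cap_speed s = 0"
  by (auto simp: cap_speed_def)

lemma cap_speed_minus: "cap_speed (- s) = - cap_speed s"
  by (simp add: cap_speed_def)

lemma cap_shear_nth [simp]:
  "cap_shear t z $ 1 = z $ 1 + t * cap_speed (z $ 2)" "cap_shear t z $ 2 = z $ 2"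
  by (simp_all add: cap_shear_def)

lemma vec2_eq_iff: "(x :: real^2) = y \<longleftrightarrow> x $ 1 = y $ 1 \<and> x $ 2 = y $ 2"
  by (simp add: vec_eq_iff forall_2)

lemma cap_shear_minus: "cap_shear t (- z) = - cap_shear t z"
  by (simp add: vec2_eq_iff cap_speed_minus)

lemma cap_shear_inverse [simp]: "cap_shear (- t) (cap_shear t z) = z"
  by (simp add: vec2_eq_iff)

lemma inj_cap_shear: "inj (cap_shear t)"
  by (metis cap_shear_inverse injI)

lemma linear_nth: "linear (\<lambda>z :: real^2. z $ i)"
  by (simp add: bounded_linear.linear bounded_linear_vec_nth)

lemma linear_uminus_nth: "linear (\<lambda>z :: real^2. - z $ i)"
  by (simp add: linear_compose_neg linear_nth)

lemma convex_nth: "convex {z :: real^2. z $ i \<le> c}" "convex {z :: real^2. c \<le> z $ i}"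
  using convex_linear_vimage[OF linear_nth, of "{..c}" i] convex_linear_vimage[OF linear_nth, of "{c..}" i]
  by (simp_all add: vimage_def)

text \<open>On each cap \<open>cap_shear t\<close> is this linear map followed by a translation, so
  convex sets inside one cap have convex images.\<close>

definition hshear :: "real \<Rightarrow> real^2 \<Rightarrow> real^2" where
  "hshear t z = vector [z $ 1 + t * z $ 2, z $ 2]"

lemma linear_hshear: "linear (hshear t)"
  by (rule linearI) (auto simp: hshear_def vec2_eq_iff algebra_simps)

lemma cap_shear_top: "z $ 2 \<ge> 1 \<Longrightarrow> cap_shear t z = vector [- t, 0] + hshear t z"
  and cap_shear_bot: "z $ 2 \<le> -1 \<Longrightarrow> cap_shear t z = vector [t, 0] + hshear t z"
  and cap_shear_mid: "-1 \<le> z $ 2 \<Longrightarrow> z $ 2 \<le> 1 \<Longrightarrow> cap_shear t z = z"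
  by (auto simp: vec2_eq_iff hshear_def cap_speed_cases algebra_simps)

lemma convex_preimage_affine:
  "linear f \<Longrightarrow> convex C \<Longrightarrow> convex {z. c + f z \<in> C}"
  using convex_linear_vimage[of f "(\<lambda>x. - c + x) ` C"] convex_translation[of C "- c"]
  by (auto simp: vimage_def image_iff algebra_simps elim!: back_subst[of convex])

text \<open>
  After a linear change of coordinates the two chosen vertices are \<open>(1, 1)\<close> and \<open>(-1, 1)\<close>.
\<close>

locale cap_polygon =
  fixes V :: "(real^2) set"
  assumes fin: "finite V"
    and sym: "\<And>z. z \<in> convex hull V \<Longrightarrow> - z \<in> convex hull V"
    and ext1: "vector [1, 1] extreme_point_of (convex hull V)"
    and ext2: "vector [-1, 1] extreme_point_of (convex hull V)"
    and above: "\<exists>b\<in>V. b $ 2 > 1"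
begin

section \<open>Decomposition of the polygon along the heights 1 and -1\<close>

abbreviation "K \<equiv> convex hull V"

lemma corners: "vector [1, 1] \<in> V" "vector [-1, 1] \<in> V" "vector [1, -1] \<in> V" "vector [-1, -1] \<in> V"
proof -
  have neg: "- x extreme_point_of K" if "x extreme_point_of K" for x
    using sym that by (rule extreme_point_of_uminus)
  show "vector [1, 1] \<in> V" "vector [-1, 1] \<in> V"
    using ext1 ext2 extreme_point_of_convex_hull by blast+
  have "- vector [1, 1] \<in> V" "- vector [-1, 1] \<in> V"
    using ext1 ext2 neg extreme_point_of_convex_hull by blast+
  moreover have "- vector [1, 1] = (vector [-1, -1] :: real^2)"
    "- vector [-1, 1] = (vector [1, -1] :: real^2)" by (auto simp: vec2_eq_iff)
  ultimately show "vector [1, -1] \<in> V" "vector [-1, -1] \<in> V" by simp_all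
qed

text \<open>A point of this height beyond one corner would place that corner strictly between it and
  the other corner, against extremality.\<close>

lemma slice: "z \<in> K \<Longrightarrow> z $ 2 = 1 \<Longrightarrow> \<bar>z $ 1\<bar> \<le> 1"
proof (rule ccontr)
  assume z: "z \<in> K" "z $ 2 = 1" "\<not> \<bar>z $ 1\<bar> \<le> 1"
  have K: "vector [1, 1] \<in> K" "vector [-1, 1] \<in> K" using corners by (auto intro: hull_inc)
  consider "z $ 1 > 1" | "z $ 1 < -1" using z(3) by linarith
  then show False
  proof cases
    case 1
    define u where "u = 2 / (z $ 1 + 1)"
    have u: "0 < u" "u < 1" "u * (z $ 1 + 1) = 2" using 1 by (auto simp: u_def field_simps)
    then have "vector [1, 1] \<in> open_segment (vector [-1, 1]) z"
      using 1 z(2) by (auto simp: in_segment vec2_eq_iff algebra_simps intro!: exI[of _ u])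
    then show False using ext1 K z by (auto simp: extreme_point_of_def)
  next
    case 2
    define u where "u = 2 / (1 - z $ 1)"
    have u: "0 < u" "u < 1" "u * (1 - z $ 1) = 2" using 2 by (auto simp: u_def field_simps)
    then have "vector [-1, 1] \<in> open_segment (vector [1, 1]) z"
      using 2 z(2) by (auto simp: in_segment vec2_eq_iff algebra_simps intro!: exI[of _ u])
    then show False using ext2 K z by (auto simp: extreme_point_of_def)
  qed
qed

lemma slice': "z \<in> K \<Longrightarrow> z $ 2 = - 1 \<Longrightarrow> \<bar>z $ 1\<bar> \<le> 1"
  using slice[of "- z"] sym by auto

lemma in_top_edge: "\<bar>(z :: real^2) $ 1\<bar> \<le> 1 \<Longrightarrow> z $ 2 = 1 \<Longrightarrow> z \<in> closed_segment (vector [-1, 1]) (vector [1, 1])"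
  by (auto simp: in_segment vec2_eq_iff algebra_simps intro!: exI[of _ "(1 + z $ 1) / 2"])

lemma in_bot_edge: "\<bar>(z :: real^2) $ 1\<bar> \<le> 1 \<Longrightarrow> z $ 2 = - 1 \<Longrightarrow> z \<in> closed_segment (vector [-1, -1]) (vector [1, -1])"
  by (auto simp: in_segment vec2_eq_iff algebra_simps intro!: exI[of _ "(1 + z $ 1) / 2"])

lemma top_edge_in_hull:
  "\<bar>(z :: real^2) $ 1\<bar> \<le> 1 \<Longrightarrow> z $ 2 = 1 \<Longrightarrow> vector [-1, 1] \<in> S \<Longrightarrow> vector [1, 1] \<in> S \<Longrightarrow> z \<in> convex hull S"
  by (rule convex_closed_segmentD[OF convex_convex_hull _ _ in_top_edge]) (simp_all add: hull_inc)

lemma bot_edge_in_hull: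
  "\<bar>(z :: real^2) $ 1\<bar> \<le> 1 \<Longrightarrow> z $ 2 = - 1 \<Longrightarrow> vector [-1, -1] \<in> S \<Longrightarrow> vector [1, -1] \<in> S \<Longrightarrow> z \<in> convex hull S"
  by (rule convex_closed_segmentD[OF convex_convex_hull _ _ in_bot_edge]) (simp_all add: hull_inc)

lemmas edge_in_hull = top_edge_in_hull bot_edge_in_hull

text \<open>The cut at height 1 lies between two corners, and these are among the selected vertices,
  so \<open>convex_hull_halfspace\<close> applies. With the two analogous lemmas below, the part of
  the polygon in each region where \<open>cap_shear t\<close> is affine is spanned by the vertices
  in that region.\<close>

lemma top_part:
  assumes "z \<in> K" "z $ 2 \<ge> 1"
  shows "z \<in> convex hull {v \<in> V. v $ 2 \<ge> 1}"
proof -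
  have "z \<in> convex hull {v \<in> V. - v $ 2 \<le> - 1}"
  proof (rule convex_hull_halfspace[OF linear_uminus_nth assms(1)])
    fix x assume "x \<in> K" "- x $ 2 = - 1"
    then show "x \<in> convex hull {v \<in> V. - v $ 2 \<le> - 1}"
      using corners slice by (intro edge_in_hull(1)) auto
  qed (use assms in simp)
  then show ?thesis by simp
qed

lemma bot_part:
  assumes "z \<in> K" "z $ 2 \<le> - 1"
  shows "z \<in> convex hull {v \<in> V. v $ 2 \<le> - 1}"
proof (rule convex_hull_halfspace[OF linear_nth assms])
  fix x assume "x \<in> K" "x $ 2 = - 1"
  then show "x \<in> convex hull {v \<in> V. v $ 2 \<le> - 1}"
    using corners slice' by (intro edge_in_hull(2)) auto
qed

lemma mid_part: 
  assumes "z \<in> K" "z $ 2 \<ge> - 1" "z $ 2 \<le> 1"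
  shows "z \<in> convex hull {v \<in> V. - 1 \<le> v $ 2 \<and> v $ 2 \<le> 1}"
proof -
  define W where "W = {v \<in> V. v $ 2 \<le> 1}"
  have W: "z \<in> convex hull W"
    unfolding W_def
  proof (rule convex_hull_halfspace[OF linear_nth assms(1,3)])
    fix x assume "x \<in> K" "x $ 2 = 1"
    then show "x \<in> convex hull {v \<in> V. v $ 2 \<le> 1}"
      using corners slice by (intro edge_in_hull(1)) auto
  qed
  have sub: "x \<in> convex hull W \<Longrightarrow> x \<in> K" for x
    using hull_mono[of W V convex] by (auto simp: W_def)
  have "z \<in> convex hull {v \<in> W. - v $ 2 \<le> 1}"
  proof (rule convex_hull_halfspace[OF linear_uminus_nth W])
    fix x assume "x \<in> convex hull W" "- x $ 2 = 1"
    then show "x \<in> convex hull {v \<in> W. - v $ 2 \<le> 1}"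
      using corners sub slice' by (intro edge_in_hull(2)) (auto simp: W_def)
  qed (use assms in auto)
  moreover have "{v \<in> W. - v $ 2 \<le> 1} = {v \<in> V. - 1 \<le> v $ 2 \<and> v $ 2 \<le> 1}"
    by (auto simp: W_def)
  ultimately show ?thesis by simp
qed

text \<open>In each region the map is affine, so the points sent into the right-hand hull form a
  convex set and it suffices to test vertices. The inclusion holds for every \<open>t\<close>; for
  equality the moved polygon must be convex.\<close>

lemma cap_shear_subset_hull: "cap_shear t ` K \<subseteq> convex hull (cap_shear t ` V)" (is "_ \<subseteq> ?C")
proof (intro image_subsetI)
  fix z assume z: "z \<in> K"
  have C: "cap_shear t v \<in> ?C" if "v \<in> V" for v using that by (auto intro: hull_inc)
  consider "z $ 2 \<ge> 1" | "z $ 2 \<le> -1" | "-1 \<le> z $ 2" "z $ 2 \<le> 1" by linarith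
  then show "cap_shear t z \<in> ?C"
  proof cases
    case 1
    have "{v \<in> V. v $ 2 \<ge> 1} \<subseteq> {z. vector [- t, 0] + hshear t z \<in> ?C}"
      using C cap_shear_top by fastforce
    then have "convex hull {v \<in> V. v $ 2 \<ge> 1} \<subseteq> {z. vector [- t, 0] + hshear t z \<in> ?C}"
      by (intro hull_minimal convex_preimage_affine linear_hshear convex_convex_hull)
    then show ?thesis using top_part[OF z 1] cap_shear_top[OF 1] by auto
  next
    case 2
    have "{v \<in> V. v $ 2 \<le> -1} \<subseteq> {z. vector [t, 0] + hshear t z \<in> ?C}"
      using C cap_shear_bot by fastforce
    then have "convex hull {v \<in> V. v $ 2 \<le> -1} \<subseteq> {z. vector [t, 0] + hshear t z \<in> ?C}"
      by (intro hull_minimal convex_preimage_affine linear_hshear convex_convex_hull)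
    then show ?thesis using bot_part[OF z 2] cap_shear_bot[OF 2] by auto
  next
    case 3
    have "{v \<in> V. - 1 \<le> v $ 2 \<and> v $ 2 \<le> 1} \<subseteq> ?C"
      using C cap_shear_mid by fastforce
    then have "convex hull {v \<in> V. - 1 \<le> v $ 2 \<and> v $ 2 \<le> 1} \<subseteq> ?C"
      by (intro hull_minimal convex_convex_hull)
    then show ?thesis using mid_part[OF z 3] cap_shear_mid[OF 3] by auto
  qed
qed

text \<open>For points of heights \<open>a\<close> and \<open>b > 1\<close>, this expression times
  \<open>(b - 1) / (b - a)\<close> is the velocity of the point where the segment between the moved
  points crosses height 1. So all crossings move to the right as time grows.\<close>

lemma cap_speed_bound: "a < 1 \<Longrightarrow> 1 - a + cap_speed a > 0"
  by (auto simp: cap_speed_def)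

text \<open>The crossing lies in the slice at height 1, so its abscissa is at most 1; clearing
  denominators gives the inequality of \<open>critical_time\<close> at time 0.\<close>

lemma crossing_le:
  assumes "a \<in> K" "b \<in> K" "a $ 2 < 1" "1 < b $ 2"
  shows "(1 - a $ 2) * (b $ 1 - 1) \<le> (b $ 2 - 1) * (1 - a $ 1)"
proof -
  obtain p where p: "p \<in> closed_segment a b" "p $ 2 = 1"
    using segment_crossing[OF linear_nth[of 2], of a 1 b a] assms by force
  then have "p \<in> K" using assms convex_closed_segmentD[OF convex_convex_hull] by blast
  then have "p $ 1 \<le> 1" using slice p by force
  obtain u where u: "p = (1 - u) *\<^sub>R a + u *\<^sub>R b" using p by (auto simp: in_segment)
  have e: "(b $ 2 - a $ 2) * u = 1 - a $ 2" using p(2) by (simp add: u algebra_simps)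
  have "(b $ 2 - a $ 2) * (p $ 1) \<le> (b $ 2 - a $ 2) * 1"
    using \<open>p $ 1 \<le> 1\<close> assms by (intro mult_left_mono) auto
  moreover have "(b $ 2 - a $ 2) * (p $ 1) = (b $ 2 - a $ 2) * a $ 1 + ((b $ 2 - a $ 2) * u) * (b $ 1 - a $ 1)"
    by (simp add: u algebra_simps)
  ultimately show ?thesis unfolding e by (simp add: algebra_simps)
qed

text \<open>
  The inequality says that the segment from the moved \<open>a\<close> to the moved \<open>b\<close> crosses the height \<open>1\<close> to
  the left of the corner \<open>(1, 1)\<close>, cleared of denominators; at the critical time one such segment
  passes through the corner.
\<close>

lemma critical_time:
  obtains t a b where "t \<ge> 0" "a \<in> V" "b \<in> V" "a $ 2 < 1" "1 < b $ 2"
    "(1 - a $ 2) * (b $ 1 - 1 + t * (b $ 2 - 1)) = (b $ 2 - 1) * (1 - a $ 1 - t * cap_speed (a $ 2))"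
    "\<And>a b. a \<in> V \<Longrightarrow> b \<in> V \<Longrightarrow> a $ 2 < 1 \<Longrightarrow> 1 < b $ 2 \<Longrightarrow>
      (1 - a $ 2) * (b $ 1 - 1 + t * (b $ 2 - 1)) \<le> (b $ 2 - 1) * (1 - a $ 1 - t * cap_speed (a $ 2))"
proof -
  \<comment> \<open>For a pair \<open>(a, b)\<close>, \<open>D\<close> is the distance from the
    crossing to the corner (1, 1) at time 0 and \<open>E\<close> is its velocity, both multiplied by
    \<open>b $ 2 - a $ 2\<close>. So \<open>D / E\<close> is an arrival time, and its minimum over
    all pairs is the first arrival.\<close>
  define D where "D = (\<lambda>(a :: real^2, b :: real^2). (b $ 2 - 1) * (1 - a $ 1) - (1 - a $ 2) * (b $ 1 - 1))"
  define E where "E = (\<lambda>(a :: real^2, b :: real^2). (b $ 2 - 1) * (1 - a $ 2 + cap_speed (a $ 2)))"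
  define P where "P = {a \<in> V. a $ 2 < 1} \<times> {b \<in> V. 1 < b $ 2}"
  have "finite P" unfolding P_def using fin by auto
  moreover have "P \<noteq> {}" using above corners by (force simp: P_def)
  ultimately obtain p where p: "p \<in> P" "\<And>p'. p' \<in> P \<Longrightarrow> D p / E p \<le> D p' / E p'"
    using Min_in[of "(\<lambda>p. D p / E p) ` P"] Min_le[of "(\<lambda>p. D p / E p) ` P"] by fastforce
  have E: "E p > 0" if "p \<in> P" for p
    using that cap_speed_bound by (auto simp: E_def P_def intro!: mult_pos_pos)
  have D: "D p \<ge> 0" if "p \<in> P" for p
    using that crossing_le by (auto simp: D_def P_def hull_inc)
  define t where "t = D p / E p"
  have t: "t \<ge> 0" "t * E p = D p" "\<And>p'. p' \<in> P \<Longrightarrow> t * E p' \<le> D p'"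
    using D[OF p(1)] E[OF p(1)] E p(2) by (auto simp: t_def field_simps)
  have *: "t * E (a, b) = D (a, b) \<longleftrightarrow>
      (1 - a $ 2) * (b $ 1 - 1 + t * (b $ 2 - 1)) = (b $ 2 - 1) * (1 - a $ 1 - t * cap_speed (a $ 2))"
    "t * E (a, b) \<le> D (a, b) \<longleftrightarrow>
      (1 - a $ 2) * (b $ 1 - 1 + t * (b $ 2 - 1)) \<le> (b $ 2 - 1) * (1 - a $ 1 - t * cap_speed (a $ 2))"
    for a b by (auto simp: E_def D_def algebra_simps)
  obtain a b where ab: "p = (a, b)" by (cases p)
  show ?thesis
    by (rule that[of t a b]) (use t p(1) * in \<open>auto simp: ab P_def\<close>)
qed

text \<open>At the first arrival all crossings still lie in the top edge, and by symmetry those at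
  height -1 in the bottom edge, so the moved polygon is convex and is the hull of the moved
  vertices. The corner (1, 1) now lies between two other moved vertices and can be omitted.\<close>

lemma drop_vertex:
  "\<exists>t\<ge>0. \<exists>W. finite W \<and> card W < card V \<and> cap_shear t ` K = convex hull W"
proof -
  obtain t a0 b0 where t: "t \<ge> 0" and a0: "a0 \<in> V" "a0 $ 2 < 1" and b0: "b0 \<in> V" "1 < b0 $ 2"
    and crit: "(1 - a0 $ 2) * (b0 $ 1 - 1 + t * (b0 $ 2 - 1)) = (b0 $ 2 - 1) * (1 - a0 $ 1 - t * cap_speed (a0 $ 2))"
    and le: "\<And>a b. a \<in> V \<Longrightarrow> b \<in> V \<Longrightarrow> a $ 2 < 1 \<Longrightarrow> 1 < b $ 2 \<Longrightarrow>
      (1 - a $ 2) * (b $ 1 - 1 + t * (b $ 2 - 1)) \<le> (b $ 2 - 1) * (1 - a $ 1 - t * cap_speed (a $ 2))"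
    using critical_time by metis
  define T where "T = cap_shear t"
  define S where "S = T ` K"
  \<comment> \<open>The reciprocal slope of the line through the corner (1, 1) and
    \<open>T b0\<close>. By \<open>crit\<close> it also contains \<open>T a0\<close>, and by
    \<open>le\<close> it supports all moved vertices: lower ones are compared with
    \<open>T b0\<close>, upper ones with \<open>T a0\<close>.\<close>
  define m where "m = (b0 $ 1 - 1 + t * (b0 $ 2 - 1)) / (b0 $ 2 - 1)"
  have m: "b0 $ 1 - 1 + t * (b0 $ 2 - 1) = (b0 $ 2 - 1) * m"
    using b0 by (simp add: m_def)
  have "(b0 $ 2 - 1) * ((1 - a0 $ 2) * m) = (b0 $ 2 - 1) * (1 - a0 $ 1 - t * cap_speed (a0 $ 2))"
    using crit unfolding m by (simp add: algebra_simps)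
  then have m': "1 - a0 $ 1 - t * cap_speed (a0 $ 2) = (1 - a0 $ 2) * m"
    using b0 by simp
  have supp: "T v $ 1 - 1 \<le> m * (T v $ 2 - 1)" if v: "v \<in> V" for v
  proof -
    consider "v $ 2 < 1" | "v $ 2 = 1" | "1 < v $ 2" by linarith
    then show ?thesis
    proof cases
      case 1
      have "(b0 $ 2 - 1) * ((1 - v $ 2) * m) \<le> (b0 $ 2 - 1) * (1 - v $ 1 - t * cap_speed (v $ 2))"
        using le[OF v b0(1) 1 b0(2)] unfolding m by (simp add: algebra_simps)
      then have "(1 - v $ 2) * m \<le> 1 - v $ 1 - t * cap_speed (v $ 2)"
        using b0 by simp
      then show ?thesis by (simp add: T_def algebra_simps)
    next
      case 2
      then show ?thesis using slice[OF hull_inc[OF v] 2] by (simp add: T_def cap_speed_cases)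
    next
      case 3
      have "(1 - a0 $ 2) * (v $ 1 - 1 + t * (v $ 2 - 1)) \<le> (1 - a0 $ 2) * ((v $ 2 - 1) * m)"
        using le[OF a0(1) v a0(2) 3] unfolding m' by (simp add: algebra_simps)
      then have "v $ 1 - 1 + t * (v $ 2 - 1) \<le> (v $ 2 - 1) * m"
        using a0 by simp
      then show ?thesis using 3 by (simp add: T_def cap_speed_cases algebra_simps)
    qed
  qed
  have half: "{x :: real^2. x $ 1 - 1 \<le> m * (x $ 2 - 1)} = {x. vector [1, - m] \<bullet> x \<le> 1 - m}"
    by (auto simp: inner_vec_def sum_2 algebra_simps)
  have "T ` V \<subseteq> {x. x $ 1 - 1 \<le> m * (x $ 2 - 1)}" using supp by auto
  then have "convex hull (T ` V) \<subseteq> {x. x $ 1 - 1 \<le> m * (x $ 2 - 1)}"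
    unfolding half by (rule hull_minimal) (rule convex_halfspace_le)
  then have supp': "x $ 1 - 1 \<le> m * (x $ 2 - 1)" if "x \<in> convex hull (T ` V)" for x
    using that by auto
  have sub: "S \<subseteq> convex hull (T ` V)"
    unfolding S_def T_def by (rule cap_shear_subset_hull)
  have odd: "- x \<in> S" if "x \<in> S" for x
    using that sym by (auto simp: S_def T_def image_iff) (metis cap_shear_minus)
  \<comment> \<open>The supporting line bounds the crossing on the right. On the left, the crossing
    of the unmoved segment has abscissa at least -1, and the movement carries it to the
    right.\<close>
  have cross: "p \<in> S" if ab: "a \<in> S" "b \<in> S" "a $ 2 < 1" "1 < b $ 2"
    and p: "p \<in> closed_segment a b" "p $ 2 = 1" for a b p
  proof -
    have "p \<in> convex hull (T ` V)"
      using ab sub p convex_closed_segmentD[OF convex_convex_hull] by blast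
    then have upper: "p $ 1 \<le> 1" using supp'[of p] p by simp
    obtain a' where a': "a' \<in> K" "a = T a'" using ab by (auto simp: S_def)
    obtain b' where b': "b' \<in> K" "b = T b'" using ab by (auto simp: S_def)
    obtain u where u: "0 \<le> u" "u \<le> 1" "p = (1 - u) *\<^sub>R a + u *\<^sub>R b"
      using p by (auto simp: in_segment)
    define p' where "p' = (1 - u) *\<^sub>R a' + u *\<^sub>R b'"
    have "p' \<in> closed_segment a' b'" using u by (auto simp: p'_def in_segment)
    then have "p' \<in> K" using a' b' convex_closed_segmentD[OF convex_convex_hull] by blast
    moreover have "p' $ 2 = 1" using p(2) by (simp add: p'_def u(3) a' b' T_def)
    ultimately have "p' $ 1 \<ge> - 1" using slice by force
    have h: "a $ 2 = a' $ 2" "b $ 2 = b' $ 2" by (simp_all add: a' b' T_def)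
    have ub: "u * (b $ 2 - 1) = (1 - u) * (1 - a $ 2)"
      using p(2) by (simp add: u(3) algebra_simps)
    have "p $ 1 = p' $ 1 + t * ((1 - u) * cap_speed (a $ 2) + u * cap_speed (b $ 2))"
      by (simp add: u(3) p'_def a' b' T_def algebra_simps)
    also have "cap_speed (b $ 2) = b $ 2 - 1" using ab by (simp add: cap_speed_cases)
    also have "(1 - u) * cap_speed (a $ 2) + u * (b $ 2 - 1) = (1 - u) * (1 - a $ 2 + cap_speed (a $ 2))"
      unfolding ub by (simp add: algebra_simps)
    also have "p' $ 1 + t * \<dots> \<ge> p' $ 1"
      using t u cap_speed_bound[OF ab(3)] by simp
    finally have "\<bar>p $ 1\<bar> \<le> 1" using \<open>p' $ 1 \<ge> - 1\<close> upper by simp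
    then have "p \<in> K" using p(2) corners by (intro edge_in_hull)
    then show ?thesis using cap_shear_mid[of p t] p(2) by (force simp: S_def T_def image_iff)
  qed
  have S2: "T x $ 2 = x $ 2" for x by (simp add: T_def)
  have img: "S \<inter> {x. P (x $ 2)} = T ` (K \<inter> {x. P (x $ 2)})" for P
    by (auto simp: S_def S2)
  have cv: "convex ((\<lambda>x. c + hshear t x) ` C)" if "convex C" for c C
    using convex_translation[OF convex_linear_image[OF linear_hshear that, of t], of c]
    by (simp add: image_image)
  have top: "convex (S \<inter> {x. 1 \<le> x $ 2})"
  proof -
    have "T ` (K \<inter> {x. 1 \<le> x $ 2}) = (\<lambda>x. vector [- t, 0] + hshear t x) ` (K \<inter> {x. 1 \<le> x $ 2})"
      by (rule image_cong) (auto simp: T_def cap_shear_top)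
    then show ?thesis unfolding img[of "\<lambda>y. 1 \<le> y"]
      using cv convex_Int[OF convex_convex_hull convex_nth(2)] by simp
  qed
  have bot: "convex (S \<inter> {x. x $ 2 \<le> - 1})"
  proof -
    have "T ` (K \<inter> {x. x $ 2 \<le> - 1}) = (\<lambda>x. vector [t, 0] + hshear t x) ` (K \<inter> {x. x $ 2 \<le> - 1})"
      by (rule image_cong) (auto simp: T_def cap_shear_bot)
    then show ?thesis unfolding img[of "\<lambda>y. y \<le> - 1"]
      using cv convex_Int[OF convex_convex_hull convex_nth(1)] by simp
  qed
  have mid: "convex (S \<inter> {x. - 1 \<le> x $ 2 \<and> x $ 2 \<le> 1})"
  proof -
    have "T ` (K \<inter> {x. - 1 \<le> x $ 2 \<and> x $ 2 \<le> 1}) = (\<lambda>x. x) ` (K \<inter> {x. - 1 \<le> x $ 2 \<and> x $ 2 \<le> 1})"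
      by (rule image_cong) (auto simp: T_def cap_shear_mid)
    moreover have "K \<inter> {x. - 1 \<le> x $ 2 \<and> x $ 2 \<le> 1} = K \<inter> ({x. - 1 \<le> x $ 2} \<inter> {x. x $ 2 \<le> 1})"
      by auto
    ultimately show ?thesis unfolding img[of "\<lambda>y. - 1 \<le> y \<and> y \<le> 1"]
      using convex_Int[OF convex_convex_hull convex_Int[OF convex_nth(2) convex_nth(1)]] by simp
  qed
  have low: "convex (S \<inter> {x. x $ 2 \<le> 1})"
  proof (rule convex_glue[OF linear_nth[of 2], where c = "-1"])
    have "S \<inter> {x. x $ 2 \<le> 1} \<inter> {x. x $ 2 \<le> - 1} = S \<inter> {x. x $ 2 \<le> - 1}" by auto
    then show "convex (S \<inter> {x. x $ 2 \<le> 1} \<inter> {x. x $ 2 \<le> - 1})" using bot by simp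
    have "S \<inter> {x. x $ 2 \<le> 1} \<inter> {x. - 1 \<le> x $ 2} = S \<inter> {x. - 1 \<le> x $ 2 \<and> x $ 2 \<le> 1}" by auto
    then show "convex (S \<inter> {x. x $ 2 \<le> 1} \<inter> {x. - 1 \<le> x $ 2})" using mid by simp
    fix a b p assume *: "a \<in> S \<inter> {x. x $ 2 \<le> 1}" "b \<in> S \<inter> {x. x $ 2 \<le> 1}" "a $ 2 < - 1" "- 1 < b $ 2"
      "p \<in> closed_segment a b" "p $ 2 = - 1"
    \<comment> \<open>Central symmetry turns a crossing at height -1 into one at height 1, with the
      ends of the segment exchanged.\<close>
    have "- p \<in> closed_segment (- b) (- a)"
    proof -
      obtain u where u: "0 \<le> u" "u \<le> 1" "p = (1 - u) *\<^sub>R a + u *\<^sub>R b"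
        using *(5) by (auto simp: in_segment)
      then show ?thesis by (auto simp: in_segment intro!: exI[of _ "1 - u"])
    qed
    moreover have "- b \<in> S" "- a \<in> S" using odd *(1,2) by blast+
    ultimately have "- p \<in> S" using *(3,4,6) by (intro cross[of "- b" "- a" "- p"]) simp_all
    then show "p \<in> S \<inter> {x. x $ 2 \<le> 1}" using odd[of "- p"] *(6) by simp
  qed
  have "convex S"
    by (rule convex_glue[OF linear_nth[of 2] low top cross])
  moreover have "T ` V \<subseteq> S" by (auto simp: S_def hull_inc)
  ultimately have eq: "S = convex hull (T ` V)"
    using sub by (meson hull_minimal subset_antisym)
  define q :: "real^2" where "q = vector [1, 1]"
  have Tq: "T q = q" by (simp add: T_def q_def cap_shear_mid)
  have qV: "q \<in> V" using corners by (simp add: q_def)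
  \<comment> \<open>By \<open>crit\<close> the segment between \<open>T a0\<close> and
    \<open>T b0\<close> meets height 1 exactly at the corner.\<close>
  have "q \<in> convex hull (T ` V - {q})"
  proof -
    have in2: "T a0 \<in> T ` V - {q}" "T b0 \<in> T ` V - {q}"
      using a0 b0 by (auto simp: q_def vec2_eq_iff T_def)
    obtain p where p: "p \<in> closed_segment (T a0) (T b0)" "p $ 2 = 1"
      using segment_crossing[OF linear_nth[of 2], of "T a0" 1 "T b0" "T a0"] a0 b0 by (force simp: S2)
    obtain u where u: "p = (1 - u) *\<^sub>R T a0 + u *\<^sub>R T b0" using p by (auto simp: in_segment)
    have e: "(b0 $ 2 - a0 $ 2) * u = 1 - a0 $ 2"
      using p(2) by (simp add: u S2 algebra_simps)
    have "(b0 $ 2 - a0 $ 2) * p $ 1 = (b0 $ 2 - a0 $ 2) * T a0 $ 1 + ((b0 $ 2 - a0 $ 2) * u) * (T b0 $ 1 - T a0 $ 1)"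
      by (simp add: u algebra_simps)
    also have "\<dots> = (b0 $ 2 - a0 $ 2) * 1"
      unfolding e using crit b0(2) by (simp add: T_def cap_speed_cases(1) algebra_simps)
    finally have "p $ 1 = 1" using a0 b0 by simp
    then have "p = q" using p(2) by (simp add: q_def vec2_eq_iff)
    have "T a0 \<in> convex hull (T ` V - {q})" "T b0 \<in> convex hull (T ` V - {q})"
      using in2 by (simp_all only: hull_inc)
    from convex_closed_segmentD[OF convex_convex_hull this p(1)] show ?thesis
      unfolding \<open>p = q\<close> .
  qed
  then have "convex hull (insert q (T ` V - {q})) = convex hull (T ` V - {q})"
    by (rule hull_redundant)
  moreover have qTV: "q \<in> T ` V" using imageI[OF qV, of T] by (simp add: Tq)
  ultimately have "S = convex hull (T ` V - {q})"
    unfolding eq by (simp add: insert_absorb)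
  moreover have "card (T ` V - {q}) < card V"
    using card_Diff1_less[of "T ` V" q] card_image_le[OF fin, of T] fin qTV by simp
  moreover have "finite (T ` V - {q})" using fin by simp
  ultimately show ?thesis using t unfolding S_def T_def by blast
qed

text \<open>Reflection in the vertical axis exchanges the corners and conjugates
  \<open>cap_shear t\<close> into \<open>cap_shear (- t)\<close>, so the forward result for the
  mirrored polygon is the backward result for this one.\<close>

lemma drop_vertex_neg:
  "\<exists>t\<ge>0. \<exists>W. finite W \<and> card W < card V \<and> cap_shear (- t) ` K = convex hull W"
proof -
  define R :: "real^2 \<Rightarrow> real^2" where "R z = vector [- z $ 1, z $ 2]" for z
  have R: "linear R" "inj R"
    by (auto intro!: linearI injI simp: R_def vec2_eq_iff)
  have RR: "R (R z) = z" for z by (simp add: R_def vec2_eq_iff)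
  have hull: "convex hull (R ` V) = R ` K"
    by (rule convex_hull_linear_image[OF R(1), symmetric])
  have shear: "cap_shear t (R z) = R (cap_shear (- t) z)" for t z
    by (simp add: R_def vec2_eq_iff)
  interpret R: cap_polygon "R ` V"
  proof
    show "finite (R ` V)" using fin by simp
    fix z assume "z \<in> convex hull (R ` V)"
    then obtain y where "y \<in> K" "z = R y" unfolding hull by auto
    then show "- z \<in> convex hull (R ` V)"
      unfolding hull using sym linear_neg[OF R(1), of y] by (metis image_eqI)
  next
    have v: "R (vector [-1, 1]) = vector [1, 1]" "R (vector [1, 1]) = vector [-1, 1]"
      by (simp_all add: R_def vec2_eq_iff)
    show "vector [1, 1] extreme_point_of convex hull (R ` V)"
      unfolding hull v(1)[symmetric] by (rule extreme_point_of_linear_inj[OF R ext2])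
    show "vector [-1, 1] extreme_point_of convex hull (R ` V)"
      unfolding hull v(2)[symmetric] by (rule extreme_point_of_linear_inj[OF R ext1])
    show "\<exists>b\<in>R ` V. 1 < b $ 2" using above by (auto simp: R_def)
  qed
  obtain t W where tW: "t \<ge> 0" "finite W" "card W < card (R ` V)" "cap_shear t ` (R ` K) = convex hull W"
    using R.drop_vertex unfolding hull by blast
  have "cap_shear (- t) ` K = R ` (cap_shear t ` (R ` K))"
    by (simp add: image_image shear RR)
  also have "\<dots> = convex hull (R ` W)"
    unfolding tW(4) by (rule convex_hull_linear_image[OF R(1)])
  finally have "cap_shear (- t) ` K = convex hull (R ` W)" .
  moreover have "card (R ` W) < card V"
    using card_image_le[OF tW(2), of R] tW(3) card_image_le[OF fin, of R] by simp
  ultimately show ?thesis using tW by blast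
qed

end

subsection \<open>Lebesgue measure in the plane\<close>

lemma real2_Basis_prod: "(\<Prod>b\<in>(Basis :: (real^2) set). f b) = f (axis 1 1) * f (axis 2 1)"
proof -
  have "axis (1::2) (1::real) \<noteq> axis 2 1" by (simp add: axis_eq_axis)
  then show ?thesis by (simp add: Basis_vec_def UNIV_2 mult.commute)
qed

lemma measurable_vector2 [measurable]:
  assumes [measurable]: "f \<in> borel_measurable M" "g \<in> borel_measurable M"
  shows "(\<lambda>x. vector [f x, g x] :: real^2) \<in> borel_measurable M"
proof -
  have "vector [f x, g x] = f x *\<^sub>R axis 1 1 + g x *\<^sub>R (axis 2 1 :: real^2)" for x
    by (simp add: vec2_eq_iff axis_def)
  then show ?thesis by simp
qed

lemma measurable_nth [measurable (raw)]:
  assumes "f \<in> borel_measurable M"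
  shows "(\<lambda>x. (f x :: real^2) $ i) \<in> borel_measurable M"
  using assms by (simp add: inner_axis[symmetric, of _ i "1::real", simplified] cart_eq_inner_axis)

lemma measurable_vector_fst_snd [measurable]:
  "(\<lambda>x. vector [fst x, snd x] :: real^2) \<in> borel_measurable (borel :: (real \<times> real) measure)"
  unfolding borel_prod[symmetric] by measurable

lemma lborel_vec2: "distr (lborel :: (real \<times> real) measure) borel (\<lambda>(x, y). vector [x, y]) = (lborel :: (real^2) measure)"
proof (rule lborel_eqI[symmetric])
  fix l u :: "real^2" assume le: "\<And>b. b \<in> Basis \<Longrightarrow> l \<bullet> b \<le> u \<bullet> b"
  have le': "l $ 1 \<le> u $ 1" "l $ 2 \<le> u $ 2"
    using le[of "axis 1 1"] le[of "axis 2 1"] by (auto simp: inner_axis)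
  have "(\<lambda>(x, y). vector [x, y]) -` box l u = box (l $ 1, l $ 2) (u $ 1, u $ 2)"
    by (auto simp: mem_box_cart forall_2 mem_box Basis_prod_def)
  then have "emeasure (distr lborel borel (\<lambda>(x, y). vector [x, y])) (box l u) = emeasure lborel (box (l $ 1, l $ 2) (u $ 1, u $ 2))"
    by (subst emeasure_distr) (auto simp: split_beta')
  also have "\<dots> = ennreal ((u $ 1 - l $ 1) * (u $ 2 - l $ 2))"
    using le' by (subst emeasure_lborel_box) (auto simp: Basis_prod_def inner_axis)
  also have "\<dots> = ennreal (\<Prod>b\<in>Basis. (u - l) \<bullet> b)"
    by (simp add: real2_Basis_prod inner_axis)
  finally show "emeasure (distr lborel borel (\<lambda>(x, y). vector [x, y])) (box l u) = ennreal (\<Prod>b\<in>Basis. (u - l) \<bullet> b)" .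
qed simp

lemma nn_integral_vec2:
  assumes [measurable]: "f \<in> borel_measurable borel"
  shows "(\<integral>\<^sup>+z. f z \<partial>lborel) = (\<integral>\<^sup>+x. \<integral>\<^sup>+y. f (vector [x, y] :: real^2) \<partial>lborel \<partial>lborel)"
    and "(\<integral>\<^sup>+z. f z \<partial>lborel) = (\<integral>\<^sup>+y. \<integral>\<^sup>+x. f (vector [x, y] :: real^2) \<partial>lborel \<partial>lborel)"
proof -
  have "(\<integral>\<^sup>+z. f z \<partial>lborel) = (\<integral>\<^sup>+p. f (vector [fst p, snd p]) \<partial>(lborel \<Otimes>\<^sub>M lborel))"
    unfolding lborel_vec2[symmetric] lborel_prod
    by (subst nn_integral_distr) (auto simp: split_beta')
  also have "\<dots> = (\<integral>\<^sup>+x. \<integral>\<^sup>+y. f (vector [x, y]) \<partial>lborel \<partial>lborel)"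
    by (subst lborel.nn_integral_fst[symmetric]) simp_all
  finally show 1: "(\<integral>\<^sup>+z. f z \<partial>lborel) = (\<integral>\<^sup>+x. \<integral>\<^sup>+y. f (vector [x, y]) \<partial>lborel \<partial>lborel)" .
  show "(\<integral>\<^sup>+z. f z \<partial>lborel) = (\<integral>\<^sup>+y. \<integral>\<^sup>+x. f (vector [x, y] :: real^2) \<partial>lborel \<partial>lborel)"
    unfolding 1 by (rule lborel_pair.Fubini') simp
qed

lemma measurable_cap_shear [measurable]: "cap_shear t \<in> borel \<rightarrow>\<^sub>M borel"
  unfolding cap_shear_def cap_speed_def by measurable

text \<open>On every horizontal line the shear is a translation, so integrating along these lines
  first gives the claim.\<close>

lemma emeasure_vimage_cap_shear:
  assumes [measurable]: "B \<in> sets borel"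
  shows "emeasure lborel (cap_shear t -` B) = emeasure lborel B"
proof -
  have m: "cap_shear t -` B \<in> sets borel"
    using measurable_sets[OF measurable_cap_shear assms] by simp
  have m2: "(\<lambda>z. indicator B (cap_shear t z) :: ennreal) \<in> borel_measurable borel" by measurable
  have "emeasure lborel (cap_shear t -` B) = (\<integral>\<^sup>+z. indicator (cap_shear t -` B) z \<partial>lborel)"
    using m by simp
  also have "\<dots> = (\<integral>\<^sup>+z. indicator B (cap_shear t z) \<partial>lborel)"
    by (intro nn_integral_cong) (simp add: indicator_def)
  also have "\<dots> = (\<integral>\<^sup>+y. \<integral>\<^sup>+x. indicator B (vector [x + t * cap_speed y, y] :: real^2) \<partial>lborel \<partial>lborel)"
    unfolding nn_integral_vec2(2)[OF m2] by (simp add: cap_shear_def)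
  also have "\<dots> = (\<integral>\<^sup>+y. \<integral>\<^sup>+x. indicator B (vector [x, y] :: real^2) \<partial>lborel \<partial>lborel)"
  proof (rule nn_integral_cong)
    fix y
    show "(\<integral>\<^sup>+x. indicator B (vector [x + t * cap_speed y, y] :: real^2) \<partial>lborel) =
      (\<integral>\<^sup>+x. indicator B (vector [x, y] :: real^2) \<partial>lborel)"
      by (subst (2) nn_integral_real_affine[where c = 1 and t = "t * cap_speed y"]) (simp_all add: add.commute)
  qed
  also have "\<dots> = emeasure lborel B"
    by (subst nn_integral_vec2(2)[symmetric]) simp_all
  finally show ?thesis .
qed

text \<open>For bounded \<open>B\<close> the preimage is the image under the inverse, whose
  determinant gives the factor; the general case follows along \<open>B \<inter> cball 0 n\<close>.
  Unbounded sets matter because the polar of a degenerate sample has infinite area.\<close>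

lemma emeasure_vimage_linear:
  fixes f :: "real^2 \<Rightarrow> real^2"
  assumes f: "linear f" "inj f"
  shows "det (matrix f) \<noteq> 0"
    and "B \<in> sets borel \<Longrightarrow> emeasure lborel (f -` B) = ennreal (1 / \<bar>det (matrix f)\<bar>) * emeasure lborel B"
proof -
  obtain g where g: "linear g" "g \<circ> f = id" "f \<circ> g = id"
    using linear_injective_isomorphism[OF f] by (auto simp: fun_eq_iff)
  define c where "c = \<bar>det (matrix g)\<bar>"
  have "matrix g ** matrix f = mat 1"
    using matrix_compose[OF f(1) g(1)] g(2) by (simp add: matrix_id_mat_1)
  then have "det (matrix g) * det (matrix f) = 1" using det_mul[of "matrix g" "matrix f"] by simp
  then have cd: "c * \<bar>det (matrix f)\<bar> = 1" by (simp add: c_def flip: abs_mult)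
  then have "det (matrix f) \<noteq> 0" "c \<noteq> 0" by auto
  then have "0 < c" and cf: "c = 1 / \<bar>det (matrix f)\<bar>"
    using cd by (auto simp: c_def field_simps)
  have gf: "g (f x) = x" "f (g x) = x" for x using g(2,3) by (simp_all add: fun_eq_iff)
  have fg: "f -` B = g ` B" for B
  proof (intro subset_antisym subsetI)
    fix x assume "x \<in> f -` B"
    then have "g (f x) \<in> g ` B" by simp
    then show "x \<in> g ` B" by (simp only: gf)
  qed (auto simp: gf)
  have fin: "emeasure lborel (f -` B) = ennreal c * emeasure lborel B"
    if B[measurable]: "B \<in> sets borel" and bd: "bounded B" for B
  proof -
    have lm: "B \<in> lmeasurable"
      using B bd by (simp add: bounded_set_imp_lmeasurable)
    have fm: "f \<in> borel_measurable borel"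
      using f by (simp add: borel_measurable_continuous_onI linear_continuous_on linear_linear)
    then have m: "f -` B \<in> sets borel" using measurable_sets[OF fm B] by simp
    have "measure lebesgue (g ` B) = c * measure lebesgue B" "g ` B \<in> lmeasurable"
      using measure_linear_image[OF g(1) lm] measurable_linear_image[OF g(1) lm] by (auto simp: c_def)
    then have "emeasure lebesgue (g ` B) = ennreal c * emeasure lebesgue B"
      using lm \<open>0 < c\<close> by (simp add: emeasure_eq_measure2 ennreal_mult)
    then show ?thesis using m B fg by simp
  qed
  show "emeasure lborel (f -` B) = ennreal (1 / \<bar>det (matrix f)\<bar>) * emeasure lborel B"
    if B[measurable]: "B \<in> sets borel"
    unfolding cf[symmetric]
  proof -
    define A where "A = (\<lambda>n::nat. B \<inter> cball 0 (real n))"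
    have inc: "incseq A" by (auto simp: A_def incseq_def)
    have UN: "(\<Union>n. A n) = B" by (auto simp: A_def real_arch_simple)
    have [measurable]: "f \<in> borel_measurable borel"
      using f by (simp add: borel_measurable_continuous_onI linear_continuous_on linear_linear)
    have mA: "A n \<in> sets borel" for n by (simp add: A_def)
    have mfA: "f -` A n \<in> sets borel" for n
      using measurable_sets[OF \<open>f \<in> borel_measurable borel\<close> mA] by simp
    have "emeasure lborel (f -` B) = (SUP n. emeasure lborel (f -` A n))"
      using SUP_emeasure_incseq[of "\<lambda>n. f -` A n" lborel] mfA inc UN
      by (auto simp: incseq_def vimage_UN[symmetric] vimage_mono image_subset_iff)
    also have "\<dots> = (SUP n. ennreal c * emeasure lborel (A n))"
      by (intro SUP_cong refl fin mA) (auto simp: A_def intro: bounded_subset[OF bounded_cball])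
    also have "\<dots> = ennreal c * (SUP n. emeasure lborel (A n))"
      by (simp add: SUP_mult_left_ennreal)
    also have "(SUP n. emeasure lborel (A n)) = emeasure lborel B"
      using SUP_emeasure_incseq[of A lborel] mA inc UN by auto
    finally show "emeasure lborel (f -` B) = ennreal c * emeasure lborel B" .
  qed
  show "det (matrix f) \<noteq> 0" by fact
qed

subsection \<open>Convexity of the reciprocal area of the polar\<close>

lemma compact_convex_real:
  fixes J :: "real set"
  assumes "compact J" "convex J" "J \<noteq> {}"
  obtains l r where "J = {l..r}" "l \<le> r"
proof -
  from assms obtain l r where J: "J = {l..r}"
    using connected_compact_interval_1[of J] convex_connected by auto
  moreover have "l \<le> r" using assms(3) J by auto
  ultimately show ?thesis by (rule that)
qed

text \<open>One-dimensional Brunn-Minkowski: \<open>J\<close> contains the combinations of the left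
  ends and of the right ends, hence the interval between them, whose length is the combination of
  the lengths.\<close>

lemma emeasure_convex_combination_le:
  fixes J0 J1 J :: "real set"
  assumes J0: "compact J0" "convex J0" "J0 \<noteq> {}" and J1: "compact J1" "convex J1" "J1 \<noteq> {}"
    and J: "convex J" "J \<in> sets borel"
    and mn: "0 \<le> \<mu>" "0 \<le> \<nu>"
    and sub: "\<And>x y. x \<in> J0 \<Longrightarrow> y \<in> J1 \<Longrightarrow> \<mu> * x + \<nu> * y \<in> J"
  shows "ennreal \<mu> * emeasure lborel J0 + ennreal \<nu> * emeasure lborel J1 \<le> emeasure lborel J"
proof -
  obtain l0 r0 where 0: "J0 = {l0..r0}" "l0 \<le> r0" using compact_convex_real[OF J0] .
  obtain l1 r1 where 1: "J1 = {l1..r1}" "l1 \<le> r1" using compact_convex_real[OF J1] .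
  have "\<mu> * l0 + \<nu> * l1 \<in> J" "\<mu> * r0 + \<nu> * r1 \<in> J"
    using sub 0 1 by auto
  then have "closed_segment (\<mu> * l0 + \<nu> * l1) (\<mu> * r0 + \<nu> * r1) \<subseteq> J"
    using J(1) by (simp add: closed_segment_subset)
  moreover have le: "\<mu> * l0 + \<nu> * l1 \<le> \<mu> * r0 + \<nu> * r1"
    using mn 0 1 by (intro add_mono mult_left_mono) auto
  ultimately have "{\<mu> * l0 + \<nu> * l1..\<mu> * r0 + \<nu> * r1} \<subseteq> J"
    by (simp add: closed_segment_eq_real_ivl)
  then have "emeasure lborel {\<mu> * l0 + \<nu> * l1..\<mu> * r0 + \<nu> * r1} \<le> emeasure lborel J"
    using J by (intro emeasure_mono) auto
  moreover have "emeasure lborel {\<mu> * l0 + \<nu> * l1..\<mu> * r0 + \<nu> * r1} = ennreal (\<mu> * (r0 - l0) + \<nu> * (r1 - l1))"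
    using le by (simp add: algebra_simps)
  also have "\<dots> = ennreal \<mu> * emeasure lborel J0 + ennreal \<nu> * emeasure lborel J1"
    using mn 0 1 by (simp add: ennreal_mult ennreal_plus)
  finally show ?thesis by simp
qed

definition vslice :: "(real^2) set \<Rightarrow> real \<Rightarrow> real set" where
  "vslice C s = {b. vector [s, b] \<in> C}"

lemma vslice_eq_image: "vslice C s = (\<lambda>z. z $ 2) ` (C \<inter> {z. z $ 1 = s})"
proof -
  have "vector [z $ 1, z $ 2] = z" for z :: "real^2" by (simp add: vec2_eq_iff)
  then show ?thesis by (force simp: vslice_def)
qed

lemma convex_vslice: "convex C \<Longrightarrow> convex (vslice C s)"
proof -
  assume "convex C"
  moreover have "{z :: real^2. z $ 1 = s} = {z. z $ 1 \<le> s} \<inter> {z. s \<le> z $ 1}" by auto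
  ultimately show ?thesis
    unfolding vslice_eq_image
    by (metis convex_Int convex_linear_image convex_nth linear_nth)
qed

lemma compact_vslice: "compact C \<Longrightarrow> compact (vslice C s)"
proof -
  assume C: "compact C"
  have "closed {z :: real^2. z $ 1 = s}"
    by (intro closed_Collect_eq continuous_intros)
  with C have "compact (C \<inter> {z. z $ 1 = s})" by (rule compact_Int_closed)
  then show ?thesis
    unfolding vslice_eq_image by (rule compact_continuous_image[rotated]) (intro continuous_intros)
qed

lemma sets_vslice:
  assumes "C \<in> sets borel"
  shows "vslice C s \<in> sets borel"
proof -
  have "(\<lambda>b. vector [s, b] :: real^2) \<in> borel_measurable borel" by measurable
  from measurable_sets[OF this assms] show ?thesis by (simp add: vslice_def vimage_def)
qed

text \<open>Fubini in vertical slices. The substitution \<open>s = a * u\<close> normalises the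
  width, so that bodies of different widths are compared at a common parameter
  \<open>u\<close>.\<close>

lemma emeasure_eq_vslice:
  assumes C[measurable]: "C \<in> sets borel"
  shows "(\<lambda>s. emeasure lborel (vslice C s)) \<in> borel_measurable borel" (is ?m)
    and "a > 0 \<Longrightarrow> emeasure lborel C = ennreal a * (\<integral>\<^sup>+u. emeasure lborel (vslice C (a * u)) \<partial>lborel)"
proof -
  have *: "emeasure lborel (vslice C s) = (\<integral>\<^sup>+b. indicator C (vector [s, b] :: real^2) \<partial>lborel)" for s
  proof -
    have "emeasure lborel (vslice C s) = (\<integral>\<^sup>+b. indicator (vslice C s) b \<partial>lborel)"
      using sets_vslice[OF C] by simp
    also have "\<dots> = (\<integral>\<^sup>+b. indicator C (vector [s, b] :: real^2) \<partial>lborel)"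
      by (rule nn_integral_cong) (simp add: indicator_def vslice_def)
    finally show ?thesis .
  qed
  show m: ?m unfolding * by measurable
  assume a: "a > 0"
  have "emeasure lborel C = (\<integral>\<^sup>+z. indicator C z \<partial>lborel)" by simp
  also have "\<dots> = (\<integral>\<^sup>+s. emeasure lborel (vslice C s) \<partial>lborel)"
    unfolding * by (subst nn_integral_vec2(1)) simp_all
  also have "\<dots> = ennreal a * (\<integral>\<^sup>+u. emeasure lborel (vslice C (a * u)) \<partial>lborel)"
    using a by (subst nn_integral_real_affine[where c = a and t = 0]) (simp_all add: m)
  finally show "emeasure lborel C = ennreal a * (\<integral>\<^sup>+u. emeasure lborel (vslice C (a * u)) \<partial>lborel)" .
qed

text \<open>Cauchy-Schwarz for \<open>(x * sqrt (p * A), y * sqrt (q * B))\<close> and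
  \<open>(sqrt (p / A), sqrt (q / B))\<close>; the difference of the two sides is an explicit
  multiple of a square.\<close>

lemma two_term_cauchy_schwarz:
  fixes p q A B x y :: real
  assumes "0 \<le> p" "0 \<le> q" "0 < A" "0 < B"
  shows "(p * x + q * y)\<^sup>2 \<le> (p * x\<^sup>2 * A + q * y\<^sup>2 * B) * (p / A + q / B)"
proof -
  have "(p * x\<^sup>2 * A + q * y\<^sup>2 * B) * (p / A + q / B) - (p * x + q * y)\<^sup>2 = p * q * (x * A - y * B)\<^sup>2 / (A * B)"
    using assms by (simp add: field_simps power2_eq_square)
  also have "\<dots> \<ge> 0" using assms by simp
  finally show ?thesis by simp
qed

text \<open>Here \<open>a\<close> is the largest abscissa, attained at some \<open>z\<close>, and
  the segment from \<open>- z\<close> to \<open>z\<close> meets every vertical line in between. The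
  interval estimate for slices requires them to be nonempty.\<close>

lemma symmetric_body_extent:
  fixes C :: "(real^2) set"
  assumes "compact C" "convex C" and sym: "\<And>z. z \<in> C \<Longrightarrow> - z \<in> C" and "\<exists>z\<in>C. z $ 1 > 0"
  obtains a where "a > 0" "\<And>s. \<bar>s\<bar> > a \<Longrightarrow> vslice C s = {}" "\<And>u. \<bar>u\<bar> \<le> 1 \<Longrightarrow> vslice C (a * u) \<noteq> {}"
proof -
  have "\<exists>z\<in>C. \<forall>w\<in>C. w $ 1 \<le> z $ 1"
    using assms(1,4) by (intro continuous_attains_sup continuous_intros) auto
  then obtain z where z: "z \<in> C" "\<And>w. w \<in> C \<Longrightarrow> w $ 1 \<le> z $ 1" by blast
  show ?thesis
  proof
    show "z $ 1 > 0" using z(2) assms(4) by force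
    show "vslice C s = {}" if "\<bar>s\<bar> > z $ 1" for s
    proof (rule ccontr)
      assume "vslice C s \<noteq> {}"
      then obtain b where "vector [s, b] \<in> C" by (auto simp: vslice_def)
      then have "s \<le> z $ 1" "- s \<le> z $ 1" using z(2) sym z(2)[of "- vector [s, b]"] by force+
      then show False using that by simp
    qed
    show "vslice C (z $ 1 * u) \<noteq> {}" if "\<bar>u\<bar> \<le> 1" for u
    proof -
      have "u *\<^sub>R z = ((1 - u) / 2) *\<^sub>R (- z) + ((1 + u) / 2) *\<^sub>R z"
        by (simp add: scaleR_left_distrib[symmetric] scaleR_left_diff_distrib[symmetric] flip: scaleR_minus_left)
          (simp add: field_simps)
      also have "\<dots> \<in> C"
        using that z(1) sym assms(2) by (intro convexD) (auto simp: field_simps)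
      finally have "u *\<^sub>R z \<in> C" .
      moreover have "u *\<^sub>R z = vector [z $ 1 * u, u * z $ 2]" by (simp add: vec2_eq_iff)
      ultimately show ?thesis by (auto simp: vslice_def)
    qed
  qed
qed

text \<open>
  \<open>C0\<close>, \<open>C1\<close>, \<open>C\<close> are the polars at two times and at their weighted mean.  The hypothesis \<open>rel\<close>
  combines points with proportional abscissas; the abscissas combine harmonically because polars at
  different times are sections of one convex body of \<open>\<real>\<^sup>3\<close> by planes through a common line.
\<close>

lemma shadow_area:
  fixes C0 C1 C :: "(real^2) set" and p q :: real
  assumes C0: "compact C0" "convex C0" "\<And>z. z \<in> C0 \<Longrightarrow> - z \<in> C0" "\<exists>z\<in>C0. z $ 1 > 0"
    and C1: "compact C1" "convex C1" "\<And>z. z \<in> C1 \<Longrightarrow> - z \<in> C1" "\<exists>z\<in>C1. z $ 1 > 0"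
    and C: "closed C" "convex C"
    and pq: "0 \<le> p" "0 \<le> q" "p + q = 1"
    and rel: "\<And>a0 a1 a u b0 b1. a0 > 0 \<Longrightarrow> a1 > 0 \<Longrightarrow> a = 1 / (p / a0 + q / a1) \<Longrightarrow>
      vector [a0 * u, b0] \<in> C0 \<Longrightarrow> vector [a1 * u, b1] \<in> C1 \<Longrightarrow>
      vector [a * u, p * a / a0 * b0 + q * a / a1 * b1] \<in> C"
    and A0: "emeasure lborel C0 = ennreal A0" "A0 > 0" and A1: "emeasure lborel C1 = ennreal A1" "A1 > 0"
  shows "ennreal (1 / (p / A0 + q / A1)) \<le> emeasure lborel C"
proof -
  obtain a0 where a0: "a0 > 0" "\<And>s. \<bar>s\<bar> > a0 \<Longrightarrow> vslice C0 s = {}" "\<And>u. \<bar>u\<bar> \<le> 1 \<Longrightarrow> vslice C0 (a0 * u) \<noteq> {}"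
    using symmetric_body_extent[OF C0] by blast
  obtain a1 where a1: "a1 > 0" "\<And>s. \<bar>s\<bar> > a1 \<Longrightarrow> vslice C1 s = {}" "\<And>u. \<bar>u\<bar> \<le> 1 \<Longrightarrow> vslice C1 (a1 * u) \<noteq> {}"
    using symmetric_body_extent[OF C1] by blast
  define a where "a = 1 / (p / a0 + q / a1)"
  have pos: "p / x + q / y > 0" if "x > 0" "y > 0" for x y
  proof (cases "p = 0")
    case False
    then have "p / x > 0" using pq that by simp
    then show ?thesis using pq that by (simp add: add_pos_nonneg)
  qed (use pq that in simp)
  have a: "a > 0" using pos[OF a0(1) a1(1)] by (simp add: a_def)
  \<comment> \<open>The coefficients of the ordinates in \<open>rel\<close>; they add up to 1 by the
    choice of \<open>a\<close>.\<close>
  define \<mu> \<nu> where "\<mu> = p * a / a0" and "\<nu> = q * a / a1"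
  have mn: "0 \<le> \<mu>" "0 \<le> \<nu>" using pq a a0 a1 by (simp_all add: \<mu>_def \<nu>_def)
  have meas: "C0 \<in> sets borel" "C1 \<in> sets borel" "C \<in> sets borel"
    using C0 C1 C by (simp_all add: compact_imp_closed borel_closed)
  let ?S = "\<lambda>C s. emeasure lborel (vslice C s)"
  have sl: "ennreal \<mu> * ?S C0 (a0 * u) + ennreal \<nu> * ?S C1 (a1 * u) \<le> ?S C (a * u)" for u
  proof (cases "\<bar>u\<bar> \<le> 1")
    case True
    show ?thesis
    proof (rule emeasure_convex_combination_le)
      show "\<mu> * x + \<nu> * y \<in> vslice C (a * u)" if "x \<in> vslice C0 (a0 * u)" "y \<in> vslice C1 (a1 * u)" for x y
        using rel[OF a0(1) a1(1) a_def, of u x y] that by (simp add: vslice_def \<mu>_def \<nu>_def)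
    qed (use C0 C1 C meas mn True a0 a1 in \<open>simp_all add: compact_vslice convex_vslice sets_vslice\<close>)
  next
    case False
    then have "\<bar>a0 * u\<bar> > a0" "\<bar>a1 * u\<bar> > a1" using a0(1) a1(1) by (simp_all add: abs_mult)
    then show ?thesis using a0(2) a1(2) by simp
  qed
  have m: "(\<lambda>u. ?S D (c * u)) \<in> borel_measurable borel" if "D \<in> sets borel" for D and c :: real
    using measurable_compose[OF _ emeasure_eq_vslice(1)[OF that], of "\<lambda>u. c * u"] by simp
  have int: "(\<integral>\<^sup>+u. ?S D (c * u) \<partial>lborel) = ennreal (B / c)"
    if "D \<in> sets borel" "c > 0" "emeasure lborel D = ennreal B" "B > 0" for D c B
  proof -
    have "ennreal c * (\<integral>\<^sup>+u. ?S D (c * u) \<partial>lborel) = ennreal c * ennreal (B / c)"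
      using emeasure_eq_vslice(2)[OF that(1,2)] that by (simp flip: ennreal_mult)
    then show ?thesis using that(2) by (simp add: ennreal_mult_cancel_left)
  qed
  have "ennreal \<mu> * ennreal (A0 / a0) + ennreal \<nu> * ennreal (A1 / a1)
      = (\<integral>\<^sup>+u. ennreal \<mu> * ?S C0 (a0 * u) + ennreal \<nu> * ?S C1 (a1 * u) \<partial>lborel)"
    using m meas by (simp add: nn_integral_add nn_integral_cmult int[OF meas(1) a0(1) A0] int[OF meas(2) a1(1) A1])
  also have "\<dots> \<le> (\<integral>\<^sup>+u. ?S C (a * u) \<partial>lborel)"
    by (intro nn_integral_mono sl)
  finally have "ennreal a * (ennreal \<mu> * ennreal (A0 / a0) + ennreal \<nu> * ennreal (A1 / a1)) \<le> emeasure lborel C"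
    unfolding emeasure_eq_vslice(2)[OF meas(3) a] by (rule mult_left_mono) simp
  also have "ennreal a * (ennreal \<mu> * ennreal (A0 / a0) + ennreal \<nu> * ennreal (A1 / a1))
      = ennreal (a * (\<mu> * (A0 / a0) + \<nu> * (A1 / a1)))"
    using mn a a0 a1 A0 A1 by (simp flip: ennreal_mult ennreal_plus)
  finally have main: "ennreal (a * (\<mu> * (A0 / a0) + \<nu> * (A1 / a1))) \<le> emeasure lborel C" .
  \<comment> \<open>The right side is \<open>a^2 * (p * A0 / a0^2 + q * A1 / a1^2)\<close>.
    Cauchy-Schwarz with \<open>x = 1 / a0\<close> and \<open>y = 1 / a1\<close>, together with
    \<open>a * (p / a0 + q / a1) = 1\<close>, eliminates the widths.\<close>
  have "1 / (p / A0 + q / A1) \<le> a * (\<mu> * (A0 / a0) + \<nu> * (A1 / a1))"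
  proof -
    have P: "p / A0 + q / A1 > 0" using pos A0 A1 by simp
    have "1 = a\<^sup>2 * (p * (1 / a0) + q * (1 / a1))\<^sup>2"
      using pos[OF a0(1) a1(1)] by (simp add: a_def power_divide)
    also have "\<dots> \<le> a\<^sup>2 * ((p * (1 / a0)\<^sup>2 * A0 + q * (1 / a1)\<^sup>2 * A1) * (p / A0 + q / A1))"
      using pq A0 A1 by (intro mult_left_mono two_term_cauchy_schwarz) simp_all
    also have "\<dots> = a * (\<mu> * (A0 / a0) + \<nu> * (A1 / a1)) * (p / A0 + q / A1)"
      by (simp add: \<mu>_def \<nu>_def power2_eq_square algebra_simps)
    finally show ?thesis using P by (simp add: pos_divide_le_eq)
  qed
  then have "ennreal (1 / (p / A0 + q / A1)) \<le> ennreal (a * (\<mu> * (A0 / a0) + \<nu> * (A1 / a1)))"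
    by (rule ennreal_leI)
  then show ?thesis using main by (rule order_trans)
qed

subsection \<open>The expectation for uniform points\<close>

declare One_nat_def [simp del]

text \<open>The polar as an intersection of strips: it depends on the points through finitely many
  linear inequalities, from which measurability in the sample and the effect of moving the points
  can be read off.\<close>

definition strips :: "nat \<Rightarrow> (nat \<Rightarrow> real^2) \<Rightarrow> (real^2) set" where
  "strips N x = {w. \<forall>i\<in>{1..N}. \<bar>w \<bullet> x i\<bar> \<le> 1}"

lemma polar_symmetric_hull: "polar (symmetric_hull N x) = strips N x"
proof (intro subset_antisym subsetI)
  fix w assume w: "w \<in> polar (symmetric_hull N x)"
  show "w \<in> strips N x"
    unfolding strips_def
  proof (intro CollectI ballI)
    fix i assume "i \<in> {1..N}"
    then have "x i \<in> symmetric_hull N x" "- x i \<in> symmetric_hull N x"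
      by (auto simp: symmetric_hull_def intro!: hull_inc)
    then have "w \<bullet> x i \<le> 1" "w \<bullet> (- x i) \<le> 1" using w unfolding polar_def by blast+
    then show "\<bar>w \<bullet> x i\<bar> \<le> 1" by simp
  qed
next
  fix w assume "w \<in> strips N x"
  then have "(\<Union>i\<in>{1..N}. {x i, - x i}) \<subseteq> {y. w \<bullet> y \<le> 1}"
    by (auto simp: strips_def)
  then have "symmetric_hull N x \<subseteq> {y. w \<bullet> y \<le> 1}"
    unfolding symmetric_hull_def by (rule hull_minimal) (rule convex_halfspace_le)
  then show "w \<in> polar (symmetric_hull N x)" by (auto simp: polar_def)
qed

lemma closed_strips: "closed (strips N x)"
proof -
  have "strips N x = (\<Inter>i\<in>{1..N}. {w. \<bar>w \<bullet> x i\<bar> \<le> 1})" by (auto simp: strips_def)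
  also have "closed \<dots>"
    by (intro closed_INT ballI closed_Collect_le continuous_intros)
  finally show ?thesis .
qed

definition polar_weight :: "nat \<Rightarrow> real \<Rightarrow> (nat \<Rightarrow> real^2) \<Rightarrow> ennreal" where
  "polar_weight N r x = ennreal (volume_powr_neg r (strips N x))"

lemma strips_cong: "(\<And>i. i \<in> {1..N} \<Longrightarrow> x i = y i) \<Longrightarrow> strips N x = strips N y"
  by (simp add: strips_def)

lemma polar_weight_cong: "(\<And>i. i \<in> {1..N} \<Longrightarrow> x i = y i) \<Longrightarrow> polar_weight N r x = polar_weight N r y"
  using strips_cong[of N x y] by (simp add: polar_weight_def)

text \<open>The area of the polar is the measure of a section of the measurable set of pairs of a
  sample and a point of its polar.\<close>

lemma measurable_polar_weight:
  "polar_weight N r \<in> borel_measurable (PiM {1..N} (\<lambda>_. borel))"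
proof -
  let ?P = "PiM {1..N} (\<lambda>_. borel :: (real^2) measure)"
  define Q where "Q = {p \<in> space (?P \<Otimes>\<^sub>M (lborel :: (real^2) measure)). \<forall>i\<in>{1..N}. \<bar>snd p \<bullet> fst p i\<bar> \<le> 1}"
  have "Q \<in> sets (?P \<Otimes>\<^sub>M lborel)"
    unfolding Q_def by measurable
  from lborel.measurable_emeasure_Pair[OF this]
  have "(\<lambda>x. emeasure lborel (Pair x -` Q)) \<in> borel_measurable ?P" .
  moreover have eq: "emeasure lborel (strips N x) = emeasure lborel (Pair x -` Q)" if "x \<in> space ?P" for x
    using that by (intro arg_cong[of _ _ "emeasure lborel"]) (auto simp: Q_def strips_def space_pair_measure)
  ultimately have [measurable]: "(\<lambda>x. emeasure lborel (strips N x)) \<in> borel_measurable ?P"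
    by (subst measurable_cong[OF eq])
  show ?thesis
    unfolding polar_weight_def volume_powr_neg_def measure_def by measurable
qed

text \<open>The expectation as a functional of the body alone, so that bodies can be moved and
  exhausted without carrying a probability space along.\<close>

definition polar_mean :: "nat \<Rightarrow> real \<Rightarrow> (real^2) set \<Rightarrow> ennreal" where
  "polar_mean N r K = (\<integral>\<^sup>+\<omega>. polar_weight N r \<omega> \<partial>PiM {1..N} (\<lambda>_. uniform_measure lborel K))"

lemma sets_PiM_uniform: "sets (PiM I (\<lambda>_. uniform_measure lborel K)) = sets (PiM I (\<lambda>_. borel))"
  by (intro sets_PiM_cong) simp_all

lemma measurable_polar_weight' [measurable]:
  "polar_weight N r \<in> borel_measurable (PiM {1..N} (\<lambda>_. uniform_measure lborel K))"
  using measurable_polar_weight by (simp cong: measurable_cong_sets add: sets_PiM_uniform)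

lemma expected_polar_power_eq:
  assumes "iid_uniform M N X K" and N: "N \<ge> 1"
  shows "expected_polar_power M N r X = polar_mean N r K"
proof -
  interpret prob_space M using assms by (simp add: iid_uniform_def)
  have ind: "indep_vars (\<lambda>_. borel) X {1..N}"
    and d: "\<And>i. i \<in> {1..N} \<Longrightarrow> distr M borel (X i) = uniform_measure lborel K"
    using assms by (auto simp: iid_uniform_def)
  have rv[measurable]: "\<And>i. i \<in> {1..N} \<Longrightarrow> X i \<in> borel_measurable M"
    using ind by (auto simp: indep_vars_def)
  have ne: "{1..N} \<noteq> {}" using N by simp
  have "distr M (PiM {1..N} (\<lambda>_. borel)) (\<lambda>x. \<lambda>i\<in>{1..N}. X i x) = PiM {1..N} (\<lambda>i. distr M borel (X i))"
    using indep_vars_iff_distr_eq_PiM'[OF ne, of X "\<lambda>_. borel"] rv ind by simp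
  also have "\<dots> = PiM {1..N} (\<lambda>_. uniform_measure lborel K)"
    by (intro PiM_cong d refl)
  finally have D: "distr M (PiM {1..N} (\<lambda>_. borel)) (\<lambda>x. \<lambda>i\<in>{1..N}. X i x) = PiM {1..N} (\<lambda>_. uniform_measure lborel K)" .
  have meas: "(\<lambda>x. \<lambda>i\<in>{1..N}. X i x) \<in> measurable M (PiM {1..N} (\<lambda>_. borel))"
    by (intro measurable_restrict rv)
  have "polar_mean N r K = (\<integral>\<^sup>+x. polar_weight N r (\<lambda>i\<in>{1..N}. X i x) \<partial>M)"
    unfolding polar_mean_def D[symmetric] 
    by (rule nn_integral_distr[OF meas]) (subst measurable_distr_eq1, rule measurable_polar_weight)
  also have "\<dots> = expected_polar_power M N r X"
    unfolding expected_polar_power_def polar_symmetric_hull polar_weight_def[symmetric]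
    by (intro nn_integral_cong polar_weight_cong) simp
  finally show ?thesis by simp
qed

text \<open>A map that scales all areas by one constant carries the uniform law on \<open>K\<close>
  to the uniform law on its image, and acting on each coordinate it carries the product laws
  likewise. It serves linear maps and, with \<open>c = 1\<close>, the cap shears.\<close>

lemma polar_mean_image:
  fixes T :: "real^2 \<Rightarrow> real^2"
  assumes T: "continuous_on UNIV T" "inj T" and K: "compact K" "emeasure lborel K > 0"
    and c: "0 < c" and scale: "\<And>B. B \<in> sets borel \<Longrightarrow> emeasure lborel (T -` B) = ennreal c * emeasure lborel B"
  shows "polar_mean N r (T ` K) = (\<integral>\<^sup>+\<omega>. polar_weight N r (\<lambda>i. T (\<omega> i)) \<partial>PiM {1..N} (\<lambda>_. uniform_measure lborel K))"
    and "emeasure lborel K = ennreal c * emeasure lborel (T ` K)"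
    and "compact (T ` K)"
proof -
  let ?u = "\<lambda>K. uniform_measure lborel K :: (real^2) measure"
  show TK: "compact (T ` K)"
    using compact_continuous_image[OF continuous_on_subset[OF T(1)] K(1)] by simp
  have Tm[measurable]: "T \<in> borel \<rightarrow>\<^sub>M borel"
    using T(1) by (simp add: borel_measurable_continuous_onI)
  have [measurable]: "K \<in> sets borel" "T ` K \<in> sets borel"
    using K TK by (simp_all add: compact_imp_closed borel_closed)
  have vim: "T -` (T ` K) = K" using T(2) by (simp add: inj_vimage_image_eq)
  show eK: "emeasure lborel K = ennreal c * emeasure lborel (T ` K)"
    using scale[of "T ` K"] vim by simp
  then have pos: "emeasure lborel (T ` K) > 0" using K by (auto simp: zero_less_iff_neq_zero)
  have fin: "emeasure lborel K \<noteq> \<infinity>" "emeasure lborel (T ` K) \<noteq> \<infinity>"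
    using K TK emeasure_compact_finite by (auto simp: less_top)
  have dist: "distr (?u K) (?u (T ` K)) T = ?u (T ` K)"
  proof (rule measure_eqI)
    fix B assume "B \<in> sets (distr (?u K) (?u (T ` K)) T)"
    then have B[measurable]: "B \<in> sets borel" by simp
    have mB: "T -` B \<in> sets borel" using measurable_sets[OF Tm B] by simp
    have "emeasure (distr (?u K) (?u (T ` K)) T) B = emeasure (?u K) (T -` B)"
      by (subst emeasure_distr) simp_all
    also have "\<dots> = emeasure lborel (K \<inter> T -` B) / emeasure lborel K"
      using mB by simp
    also have "K \<inter> T -` B = T -` (T ` K \<inter> B)" using vim by auto
    also have "emeasure lborel (T -` (T ` K \<inter> B)) = ennreal c * emeasure lborel (T ` K \<inter> B)"
      by (rule scale) simp
    also have "ennreal c * emeasure lborel (T ` K \<inter> B) / emeasure lborel K = emeasure lborel (T ` K \<inter> B) / emeasure lborel (T ` K)"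
      unfolding eK using c divide_mult_eq[of "ennreal c" "emeasure lborel (T ` K \<inter> B)" "emeasure lborel (T ` K)"]
      by (simp add: mult.commute)
    also have "\<dots> = emeasure (?u (T ` K)) B" by simp
    finally show "emeasure (distr (?u K) (?u (T ` K)) T) B = emeasure (?u (T ` K)) B" .
  qed simp
  have prob: "prob_space (?u K)" "prob_space (?u (T ` K))"
    using K pos fin by (auto intro!: prob_space_uniform_measure simp: zero_less_iff_neq_zero)
  have "distr (PiM {1..N} (\<lambda>_. ?u K)) (PiM {1..N} (\<lambda>_. ?u (T ` K))) (compose {1..N} T)
      = PiM {1..N} (\<lambda>_. distr (?u K) (?u (T ` K)) T)"
    by (rule distr_PiM_finite_prob_space') (auto simp: prob)
  then have D: "PiM {1..N} (\<lambda>_. ?u (T ` K)) = distr (PiM {1..N} (\<lambda>_. ?u K)) (PiM {1..N} (\<lambda>_. ?u (T ` K))) (compose {1..N} T)"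
    by (simp add: dist)
  have cm: "compose {1..N} T \<in> measurable (PiM {1..N} (\<lambda>_. ?u K)) (PiM {1..N} (\<lambda>_. ?u (T ` K)))"
    unfolding compose_def by measurable
  have "polar_mean N r (T ` K) = (\<integral>\<^sup>+\<omega>. polar_weight N r (compose {1..N} T \<omega>) \<partial>PiM {1..N} (\<lambda>_. ?u K))"
    unfolding polar_mean_def 
    by (subst D, rule nn_integral_distr[OF cm]) (subst measurable_distr_eq1, rule measurable_polar_weight')
  also have "\<dots> = (\<integral>\<^sup>+\<omega>. polar_weight N r (\<lambda>i. T (\<omega> i)) \<partial>PiM {1..N} (\<lambda>_. ?u K))"
    by (intro nn_integral_cong polar_weight_cong) (simp add: compose_def)
  finally show "polar_mean N r (T ` K) = (\<integral>\<^sup>+\<omega>. polar_weight N r (\<lambda>i. T (\<omega> i)) \<partial>PiM {1..N} (\<lambda>_. ?u K))" .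
qed

text \<open>Since \<open>w \<bullet> f x = adjoint f w \<bullet> x\<close>, the polar of the moved
  sample is the preimage of the polar under the adjoint, and its area is divided by
  \<open>d\<close>. For infinite area both sides are 0.\<close>

lemma polar_weight_linear_image:
  assumes f: "linear f" "inj f" and d: "d = \<bar>det (matrix f)\<bar>"
  shows "polar_weight N r (\<lambda>i. f (x i)) = ennreal (d powr r) * polar_weight N r x"
proof -
  let ?g = "adjoint f"
  have g: "linear ?g" "det (matrix ?g) = det (matrix f)"
    using f by (simp_all add: adjoint_linear matrix_adjoint det_transpose)
  have d0: "d > 0" using emeasure_vimage_linear(1)[OF f] d by simp
  have "inj ?g"
    using g d0 d f by (metis abs_0 det_nz_iff_inj less_irrefl)
  have "strips N (\<lambda>i. f (x i)) = ?g -` strips N x"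
    using f by (simp add: strips_def vimage_def adjoint_clauses)
  then have e: "emeasure lborel (strips N (\<lambda>i. f (x i))) = ennreal (1 / d) * emeasure lborel (strips N x)"
    using emeasure_vimage_linear(2)[OF g(1) \<open>inj ?g\<close> borel_closed[OF closed_strips]] g(2) d by simp
  show ?thesis
  proof (cases "emeasure lborel (strips N x) = \<infinity>")
    case True
    then show ?thesis using e d0 by (simp add: polar_weight_def volume_powr_neg_def ennreal_mult_top)
  next
    case False
    then have "emeasure lborel (strips N (\<lambda>i. f (x i))) \<noteq> \<infinity>"
      using e by (simp add: ennreal_mult_eq_top_iff)
    moreover have "measure lborel (strips N (\<lambda>i. f (x i))) = measure lborel (strips N x) / d"
      unfolding measure_def e using d0 by (simp add: enn2real_mult)
    moreover have "(measure lborel (strips N x) / d) powr (- r) = d powr r * measure lborel (strips N x) powr (- r)"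
      using d0 by (simp add: powr_divide powr_minus_divide field_simps)
    ultimately show ?thesis using False
      by (simp add: polar_weight_def volume_powr_neg_def ennreal_mult)
  qed
qed

lemma polar_mean_linear_image:
  assumes f: "linear f" "inj f" and K: "compact K" "emeasure lborel K > 0"
  obtains d where "d > 0" "polar_mean N r (f ` K) = ennreal (d powr r) * polar_mean N r K"
    "measure lborel (f ` K) = d * measure lborel K" "compact (f ` K)" "emeasure lborel (f ` K) > 0"
proof -
  define d where "d = \<bar>det (matrix f)\<bar>"
  have d: "d > 0" using emeasure_vimage_linear(1)[OF f] by (simp add: d_def)
  have cont: "continuous_on UNIV f" using f(1) by (simp add: linear_continuous_on linear_linear)
  note im = polar_mean_image[OF cont f(2) K, of "1 / d"]
  have "0 < 1 / d" and sc: "\<And>B. B \<in> sets borel \<Longrightarrow> emeasure lborel (f -` B) = ennreal (1 / d) * emeasure lborel B"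
    using emeasure_vimage_linear(2)[OF f] d by (simp_all add: d_def)
  note im = im[OF this]
  have "polar_mean N r (f ` K) = (\<integral>\<^sup>+\<omega>. polar_weight N r (\<lambda>i. f (\<omega> i)) \<partial>PiM {1..N} (\<lambda>_. uniform_measure lborel K))"
    by (rule im(1))
  also have "\<dots> = (\<integral>\<^sup>+\<omega>. ennreal (d powr r) * polar_weight N r \<omega> \<partial>PiM {1..N} (\<lambda>_. uniform_measure lborel K))"
    by (simp only: polar_weight_linear_image[OF f d_def])
  also have "\<dots> = ennreal (d powr r) * polar_mean N r K"
    unfolding polar_mean_def by (rule nn_integral_cmult[OF measurable_polar_weight'])
  finally have "polar_mean N r (f ` K) = ennreal (d powr r) * polar_mean N r K" .
  moreover have "measure lborel K = (1 / d) * measure lborel (f ` K)"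
  proof -
    have "emeasure lborel (f ` K) = ennreal (measure lborel (f ` K))"
      using emeasure_compact_finite[OF im(3)] by (intro emeasure_eq_ennreal_measure) auto
    then have "emeasure lborel K = ennreal ((1 / d) * measure lborel (f ` K))"
      using im(2) d by (simp flip: ennreal_mult)
    then show ?thesis using d by (simp add: measure_def)
  qed
  then have "measure lborel (f ` K) = d * measure lborel K" using d by simp
  moreover have "emeasure lborel (f ` K) > 0"
    using K(2) im(2) by (auto simp: zero_less_iff_neq_zero)
  ultimately show ?thesis using that d im(3) by blast
qed

section \<open>Almost every sample has a bounded polar\<close>

lemma planar_line_null:
  fixes v :: "real^2"
  assumes "v \<noteq> 0"
  shows "emeasure lborel {x :: real^2. x $ 1 * v $ 2 - x $ 2 * v $ 1 = 0} = 0"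
proof -
  have eq: "{x :: real^2. x $ 1 * v $ 2 - x $ 2 * v $ 1 = 0} = {x. vector [v $ 2, - (v $ 1)] \<bullet> x = 0}"
    by (auto simp: inner_vec_def sum_2 algebra_simps)
  have "(vector [v $ 2, - (v $ 1)] :: real^2) \<noteq> 0"
    using assms by (auto simp: vec2_eq_iff)
  then have "negligible {x :: real^2. x $ 1 * v $ 2 - x $ 2 * v $ 1 = 0}"
    unfolding eq by (intro negligible_hyperplane) simp
  moreover have "{x :: real^2. x $ 1 * v $ 2 - x $ 2 * v $ 1 = 0} \<in> sets borel" by measurable
  ultimately show ?thesis
    by (simp add: negligible_iff_emeasure0)
qed

text \<open>Given a nonzero second point, the first one almost surely avoids the line through it and
  the origin, and Fubini over the first coordinate gives the claim. The map \<open>T\<close> is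
  there because nondegeneracy is wanted at the end times of the movement.\<close>

lemma AE_independent_pair:
  fixes T :: "real^2 \<Rightarrow> real^2" and N :: nat
  assumes Tm[measurable]: "T \<in> borel \<rightarrow>\<^sub>M borel" and inv: "\<And>B. B \<in> sets borel \<Longrightarrow> emeasure lborel (T -` B) = emeasure lborel B"
    and K: "compact K" "emeasure lborel K > 0" and N: "N \<ge> 2"
  shows "AE \<omega> in PiM {1..N} (\<lambda>_. uniform_measure lborel K).
    T (\<omega> 1) $ 1 * T (\<omega> 2) $ 2 - T (\<omega> 1) $ 2 * T (\<omega> 2) $ 1 \<noteq> 0"
proof -
  let ?u = "uniform_measure lborel K :: (real^2) measure"
  have [measurable]: "K \<in> sets borel"
    using K by (simp add: compact_imp_closed borel_closed)
  have fin: "emeasure lborel K \<noteq> \<infinity>"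
    using K emeasure_compact_finite by (auto simp: less_top)
  have prob: "prob_space ?u"
    using K fin by (auto intro!: prob_space_uniform_measure simp: zero_less_iff_neq_zero)
  interpret uK: prob_space ?u by fact
  interpret PK: product_sigma_finite "\<lambda>_. ?u" ..
  define bad where "bad = {\<omega> \<in> space (PiM {1..N} (\<lambda>_. ?u)). T (\<omega> 1) $ 1 * T (\<omega> 2) $ 2 - T (\<omega> 1) $ 2 * T (\<omega> 2) $ 1 = 0}"
  have I: "{1..N} = insert 1 {2..N}" using N by auto
  have comp: "(\<lambda>\<omega>. \<omega> i) \<in> PiM {1..N} (\<lambda>_. ?u) \<rightarrow>\<^sub>M borel" if "i \<in> {1..N}" for i
  proof -
    have eq: "measurable (PiM {1..N} (\<lambda>_. ?u)) ?u = borel_measurable (PiM {1..N} (\<lambda>_. ?u))"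
      by (rule measurable_cong_sets) simp_all
    show ?thesis using measurable_component_singleton[OF that, of "\<lambda>_. ?u"] unfolding eq .
  qed
  have [measurable]: "(\<lambda>\<omega>. T (\<omega> 1)) \<in> PiM {1..N} (\<lambda>_. ?u) \<rightarrow>\<^sub>M borel"
    "(\<lambda>\<omega>. T (\<omega> 2)) \<in> PiM {1..N} (\<lambda>_. ?u) \<rightarrow>\<^sub>M borel"
    using N by (auto intro!: measurable_compose[OF comp Tm])
  have bad[measurable]: "bad \<in> sets (PiM {1..N} (\<lambda>_. ?u))"
    unfolding bad_def by measurable
  have vimage_null: "AE x in ?u. T x \<notin> B" if B[measurable]: "B \<in> sets borel" and "emeasure lborel B = 0" for B
  proof -
    have "T -` B \<in> sets borel" using measurable_sets[OF Tm B] by simp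
    then have "T -` B \<in> null_sets lborel" using inv[OF B] that by (auto intro!: null_setsI)
    then have "AE x in lborel. x \<notin> T -` B" by (rule AE_not_in)
    then show ?thesis by (intro AE_uniform_measureI) (auto elim!: eventually_mono)
  qed
  have inner: "(\<integral>\<^sup>+x. indicator bad (y(1 := x)) \<partial>?u) = 0" if "T (y 2) \<noteq> 0" for y
  proof -
    have "{x :: real^2. x $ 1 * T (y 2) $ 2 - x $ 2 * T (y 2) $ 1 = 0} \<in> sets borel" by measurable
    from vimage_null[OF this planar_line_null[OF that]]
    have AE: "AE x in ?u. T x $ 1 * T (y 2) $ 2 - T x $ 2 * T (y 2) $ 1 \<noteq> 0" by simp
    have "(\<integral>\<^sup>+x. indicator bad (y(1 := x)) \<partial>?u) = (\<integral>\<^sup>+x. 0 \<partial>?u)"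
      by (rule nn_integral_cong_AE) (use AE in eventually_elim, simp add: bad_def indicator_def)
    then show ?thesis by simp
  qed
  have "AE x in ?u. T x \<notin> {0}" by (rule vimage_null) simp_all
  then have "AE y in PiM {2..N} (\<lambda>_. ?u). T (y 2) \<notin> {0}"
    using N prob by (intro AE_PiM_component[of _ "\<lambda>_. ?u" 2 "\<lambda>x. T x \<notin> {0}"]) auto
  then have outer: "AE y in PiM {2..N} (\<lambda>_. ?u). (\<integral>\<^sup>+x. indicator bad (y(1 := x)) \<partial>?u) = 0"
    by (auto elim!: eventually_mono intro: inner)
  have "emeasure (PiM {1..N} (\<lambda>_. ?u)) bad = (\<integral>\<^sup>+\<omega>. indicator bad \<omega> \<partial>PiM {1..N} (\<lambda>_. ?u))"
    by simp
  also have "\<dots> = (\<integral>\<^sup>+y. \<integral>\<^sup>+x. indicator bad (y(1 := x)) \<partial>?u \<partial>PiM {2..N} (\<lambda>_. ?u))"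
    using bad unfolding I by (intro PK.product_nn_integral_insert) auto
  also have "\<dots> = (\<integral>\<^sup>+y. 0 \<partial>PiM {2..N} (\<lambda>_. ?u))"
    by (rule nn_integral_cong_AE) (use outer in eventually_elim, simp)
  finally have "bad \<in> null_sets (PiM {1..N} (\<lambda>_. ?u))" by (auto intro!: null_setsI)
  from AE_not_in[OF this] show ?thesis
    by (rule AE_mp) (auto simp: bad_def intro!: AE_I2)
qed

lemma strips_ball:
  obtains s where "s > 0" "ball 0 s \<subseteq> strips N x"
proof -
  define S where "S = (\<Sum>i\<in>{1..N}. norm (x i))"
  have S: "norm (x i) \<le> S" if "i \<in> {1..N}" for i
    unfolding S_def using that by (intro member_le_sum) auto
  have S0: "S \<ge> 0" unfolding S_def by (intro sum_nonneg) auto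
  show ?thesis
  proof
    show "1 / (1 + S) > 0" using S0 by simp
    show "ball 0 (1 / (1 + S)) \<subseteq> strips N x"
    proof
      fix w :: "real^2" assume "w \<in> ball 0 (1 / (1 + S))"
      then have w: "norm w \<le> 1 / (1 + S)" by simp
      have "\<bar>w \<bullet> x i\<bar> \<le> 1" if "i \<in> {1..N}" for i
      proof -
        have "\<bar>w \<bullet> x i\<bar> \<le> norm w * norm (x i)" by (rule Cauchy_Schwarz_ineq2)
        also have "\<dots> \<le> 1 / (1 + S) * S" using w S[OF that] S0 by (intro mult_mono) auto
        also have "\<dots> \<le> 1" using S0 by simp
        finally show ?thesis .
      qed
      then show "w \<in> strips N x" by (simp add: strips_def)
    qed
  qed
qed

text \<open>Cramer's rule recovers \<open>w\<close> from its inner products with \<open>x 1\<close>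
  and \<open>x 2\<close>, which are at most 1 in absolute value on the strips.\<close>

lemma strips_bounded:
  assumes N: "N \<ge> 2" and det: "x 1 $ 1 * x 2 $ 2 - x 1 $ 2 * x 2 $ 1 \<noteq> 0" (is "?d \<noteq> 0")
  shows "bounded (strips N x)"
proof -
  define B where "B = (\<bar>x 2 $ 2\<bar> + \<bar>x 1 $ 2\<bar> + \<bar>x 2 $ 1\<bar> + \<bar>x 1 $ 1\<bar>) / \<bar>?d\<bar>"
  have "norm w \<le> B" if "w \<in> strips N x" for w
  proof -
    define s t where "s = w \<bullet> x 1" and "t = w \<bullet> x 2"
    have st: "\<bar>s\<bar> \<le> 1" "\<bar>t\<bar> \<le> 1" using that N by (auto simp: strips_def s_def t_def)
    have e: "w $ 1 * ?d = s * x 2 $ 2 - t * x 1 $ 2" "w $ 2 * ?d = t * x 1 $ 1 - s * x 2 $ 1"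
      by (simp_all add: s_def t_def inner_vec_def sum_2 algebra_simps)
    have b: "\<bar>s * p - t * q\<bar> \<le> \<bar>p\<bar> + \<bar>q\<bar>" "\<bar>t * p - s * q\<bar> \<le> \<bar>p\<bar> + \<bar>q\<bar>" for p q
    proof -
      have "\<bar>s * p\<bar> \<le> \<bar>p\<bar>" "\<bar>t * q\<bar> \<le> \<bar>q\<bar>" "\<bar>t * p\<bar> \<le> \<bar>p\<bar>" "\<bar>s * q\<bar> \<le> \<bar>q\<bar>"
        using st by (simp_all add: abs_mult mult_left_le_one_le)
      then show "\<bar>s * p - t * q\<bar> \<le> \<bar>p\<bar> + \<bar>q\<bar>" "\<bar>t * p - s * q\<bar> \<le> \<bar>p\<bar> + \<bar>q\<bar>" by linarith+
    qed
    have "\<bar>w $ 1\<bar> * \<bar>?d\<bar> \<le> \<bar>x 2 $ 2\<bar> + \<bar>x 1 $ 2\<bar>" "\<bar>w $ 2\<bar> * \<bar>?d\<bar> \<le> \<bar>x 1 $ 1\<bar> + \<bar>x 2 $ 1\<bar>"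
      using b e by (simp_all flip: abs_mult)
    then have "(\<bar>w $ 1\<bar> + \<bar>w $ 2\<bar>) * \<bar>?d\<bar> \<le> \<bar>x 2 $ 2\<bar> + \<bar>x 1 $ 2\<bar> + \<bar>x 2 $ 1\<bar> + \<bar>x 1 $ 1\<bar>"
      unfolding distrib_right by linarith
    then have "\<bar>w $ 1\<bar> + \<bar>w $ 2\<bar> \<le> B" using det by (simp add: B_def pos_le_divide_eq)
    moreover have "norm w \<le> \<bar>w $ 1\<bar> + \<bar>w $ 2\<bar>" using norm_le_l1_cart[of w] by (simp add: sum_2)
    ultimately show ?thesis by simp
  qed
  then show ?thesis by (auto simp: bounded_iff)
qed

lemma convex_strips: "convex (strips N x)"
proof -
  have "strips N x = (\<Inter>i\<in>{1..N}. {w. x i \<bullet> w \<le> 1} \<inter> {w. x i \<bullet> w \<ge> -1})"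
    by (auto simp: strips_def inner_commute abs_le_iff)
  then show ?thesis by (auto intro!: convex_INT convex_Int convex_halfspace_le convex_halfspace_ge)
qed

lemma strips_minus: "z \<in> strips N x \<Longrightarrow> - z \<in> strips N x"
  by (simp add: strips_def)

lemma polar_weight_finite:
  assumes N: "N \<ge> 2" and det: "x 1 $ 1 * x 2 $ 2 - x 1 $ 2 * x 2 $ 1 \<noteq> 0"
  obtains A where "A > 0" "emeasure lborel (strips N x) = ennreal A"
    "polar_weight N r x = ennreal (A powr - r)" "compact (strips N x)" "\<exists>z\<in>strips N x. z $ 1 > 0"
proof -
  have cpt: "compact (strips N x)"
    using strips_bounded[OF assms] closed_strips by (simp add: compact_eq_bounded_closed)
  then have fin: "emeasure lborel (strips N x) \<noteq> \<infinity>" using emeasure_compact_finite by (auto simp: less_top)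
  obtain s where s: "s > 0" "ball 0 s \<subseteq> strips N x" by (rule strips_ball)
  define A where "A = measure lborel (strips N x)"
  have e: "emeasure lborel (strips N x) = ennreal A"
    using fin by (simp add: A_def emeasure_eq_ennreal_measure)
  have "0 < measure lborel (ball (0 :: real^2) s)" using s(1) by (rule content_ball_pos)
  also have "\<dots> \<le> A"
    unfolding A_def using s(2) fin borel_closed[OF closed_strips]
    by (intro measure_mono_fmeasurable) (auto simp: fmeasurable_def less_top)
  finally have "A > 0" .
  moreover have "vector [s / 2, 0] \<in> strips N x"
  proof -
    have "norm (vector [s / 2, 0] :: real^2) \<le> \<bar>s / 2\<bar>"
      using norm_le_l1_cart[of "vector [s / 2, 0] :: real^2"] by (simp add: sum_2)
    then show ?thesis using s by (auto intro!: subsetD[OF s(2)])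
  qed
  then have "\<exists>z\<in>strips N x. z $ 1 > 0" using s(1) by force
  moreover have "polar_weight N r x = ennreal (A powr - r)"
    using fin by (simp add: polar_weight_def volume_powr_neg_def A_def)
  ultimately show ?thesis using that e cpt by blast
qed

text \<open>\<open>shadow_area\<close> is applied to the polars at times \<open>t0\<close> and
  \<open>t1\<close>, whose weighted mean is time 0, the position of \<open>x\<close> itself. It
  bounds the reciprocal area there by the mean of the two reciprocal areas, and
  \<open>r \<ge> 1\<close> makes the power increasing and convex.\<close>

lemma polar_weight_convex:
  fixes x :: "nat \<Rightarrow> real^2"
  assumes N: "N \<ge> 2" and r: "r \<ge> 1" and pq: "0 \<le> p" "0 \<le> q" "p + q = 1" and pt: "p * t0 + q * t1 = 0"
    and det0: "cap_shear t0 (x 1) $ 1 * cap_shear t0 (x 2) $ 2 - cap_shear t0 (x 1) $ 2 * cap_shear t0 (x 2) $ 1 \<noteq> 0"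
    and det1: "cap_shear t1 (x 1) $ 1 * cap_shear t1 (x 2) $ 2 - cap_shear t1 (x 1) $ 2 * cap_shear t1 (x 2) $ 1 \<noteq> 0"
  shows "polar_weight N r x \<le> ennreal p * polar_weight N r (\<lambda>i. cap_shear t0 (x i))
    + ennreal q * polar_weight N r (\<lambda>i. cap_shear t1 (x i))"
proof -
  obtain A0 where A0: "A0 > 0" "emeasure lborel (strips N (\<lambda>i. cap_shear t0 (x i))) = ennreal A0"
    "polar_weight N r (\<lambda>i. cap_shear t0 (x i)) = ennreal (A0 powr - r)" "compact (strips N (\<lambda>i. cap_shear t0 (x i)))"
    "\<exists>z\<in>strips N (\<lambda>i. cap_shear t0 (x i)). z $ 1 > 0"
    by (rule polar_weight_finite[OF N, where x = "\<lambda>i. cap_shear t0 (x i)", OF det0])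
  obtain A1 where A1: "A1 > 0" "emeasure lborel (strips N (\<lambda>i. cap_shear t1 (x i))) = ennreal A1"
    "polar_weight N r (\<lambda>i. cap_shear t1 (x i)) = ennreal (A1 powr - r)" "compact (strips N (\<lambda>i. cap_shear t1 (x i)))"
    "\<exists>z\<in>strips N (\<lambda>i. cap_shear t1 (x i)). z $ 1 > 0"
    by (rule polar_weight_finite[OF N, where x = "\<lambda>i. cap_shear t1 (x i)", OF det1])
  have area: "ennreal (1 / (p / A0 + q / A1)) \<le> emeasure lborel (strips N x)"
  proof (rule shadow_area[OF A0(4) convex_strips strips_minus A0(5) A1(4) convex_strips strips_minus A1(5)
        closed_strips convex_strips pq _ A0(2,1) A1(2,1)])
    fix a0 a1 a u b0 b1 :: real
    assume a01: "a0 > 0" "a1 > 0" and a: "a = 1 / (p / a0 + q / a1)"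
      and v0: "vector [a0 * u, b0] \<in> strips N (\<lambda>i. cap_shear t0 (x i))"
      and v1: "vector [a1 * u, b1] \<in> strips N (\<lambda>i. cap_shear t1 (x i))"
    define m where "m = p * a / a0"
    define n where "n = q * a / a1"
    have "p / a0 + q / a1 > 0"
    proof (cases "p = 0")
      case False
      then have "p / a0 > 0" using pq a01 by simp
      then show ?thesis using pq a01 by (simp add: add_pos_nonneg)
    qed (use pq a01 in simp)
    then have a': "a > 0" "a * (p / a0 + q / a1) = 1" by (simp_all add: a)
    have mn: "m \<ge> 0" "n \<ge> 0" "m + n = 1" using a' a01 pq by (simp_all add: m_def n_def distrib_left mult.commute)
    have ma: "m * a0 = p * a" "n * a1 = q * a" using a01 by (simp_all add: m_def n_def)
    show "vector [a * u, p * a / a0 * b0 + q * a / a1 * b1] \<in> strips N x"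
      unfolding strips_def m_def[symmetric] n_def[symmetric]
    proof (intro CollectI ballI)
      fix i assume i: "i \<in> {1..N}"
      define c where "c = cap_speed (x i $ 2)"
      define s0 where "s0 = a0 * u * (x i $ 1 + t0 * c) + b0 * x i $ 2"
      define s1 where "s1 = a1 * u * (x i $ 1 + t1 * c) + b1 * x i $ 2"
      have s: "\<bar>s0\<bar> \<le> 1" "\<bar>s1\<bar> \<le> 1"
        using v0 v1 i by (auto simp: strips_def inner_vec_def sum_2 s0_def s1_def c_def)
      \<comment> \<open>Because \<open>m * a0 = p * a\<close> and \<open>n * a1 = q * a\<close>, the
        abscissas contribute \<open>a * u\<close> times the mean of the two moved positions, and
        \<open>p * t0 + q * t1 = 0\<close> cancels the movement.\<close>
      have "m * s0 + n * s1 = (m * a0) * u * (x i $ 1 + t0 * c) + (n * a1) * u * (x i $ 1 + t1 * c) + (m * b0 + n * b1) * x i $ 2"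
        by (simp add: s0_def s1_def algebra_simps)
      also have "\<dots> = a * u * ((p + q) * x i $ 1 + (p * t0 + q * t1) * c) + (m * b0 + n * b1) * x i $ 2"
        unfolding ma by (simp add: algebra_simps)
      also have "\<dots> = vector [a * u, m * b0 + n * b1] \<bullet> x i"
        unfolding pq pt by (simp add: inner_vec_def sum_2)
      finally have "vector [a * u, m * b0 + n * b1] \<bullet> x i = m * s0 + n * s1" by simp
      moreover have "\<bar>m * s0 + n * s1\<bar> \<le> m * \<bar>s0\<bar> + n * \<bar>s1\<bar>"
        using mn abs_triangle_ineq[of "m * s0" "n * s1"] by (simp add: abs_mult)
      moreover have "m * \<bar>s0\<bar> + n * \<bar>s1\<bar> \<le> m * 1 + n * 1"
        using mn s by (intro add_mono mult_left_mono) auto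
      ultimately show "\<bar>vector [a * u, m * b0 + n * b1] \<bullet> x i\<bar> \<le> 1" using mn by simp
    qed
  qed
  have conv: "(p * (1 / A0) + q * (1 / A1)) powr r \<le> p * (1 / A0) powr r + q * (1 / A1) powr r"
  proof -
    have p: "p = 1 - q" using pq by simp
    show ?thesis
      using convex_onD[OF powr_convex[OF r], of q "1 / A0" "1 / A1"] A0(1) A1(1) pq unfolding p by simp
  qed
  have P: "p / A0 + q / A1 > 0"
  proof (cases "p = 0")
    case False
    then have "p / A0 > 0" using pq A0 by simp
    then show ?thesis using pq A1 by (simp add: add_pos_nonneg)
  qed (use pq A1 in simp)
  have "polar_weight N r x \<le> ennreal (p * (1 / A0) powr r + q * (1 / A1) powr r)"
  proof (cases "emeasure lborel (strips N x) = \<infinity>")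
    \<comment> \<open>At time 0 the polar may be unbounded; the left side is then 0 by
      convention.\<close>
    case True
    then show ?thesis by (simp add: polar_weight_def volume_powr_neg_def)
  next
    case False
    define A where "A = measure lborel (strips N x)"
    have "emeasure lborel (strips N x) = ennreal A" using False by (simp add: A_def emeasure_eq_ennreal_measure)
    then have le: "1 / (p / A0 + q / A1) \<le> A" using area by (simp add: A_def)
    have "A powr - r \<le> (1 / (p / A0 + q / A1)) powr - r"
      using le P r by (intro powr_mono2') auto
    also have "\<dots> = (p * (1 / A0) + q * (1 / A1)) powr r"
      using P by (simp add: powr_divide powr_minus_divide)
    also note conv
    finally show ?thesis using False
      by (simp add: polar_weight_def volume_powr_neg_def A_def ennreal_leI)
  qed
  also have "\<dots> = ennreal p * ennreal (A0 powr - r) + ennreal q * ennreal (A1 powr - r)"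
    using pq A0(1) A1(1) by (simp add: powr_divide powr_minus_divide flip: ennreal_mult ennreal_plus)
  finally show ?thesis unfolding A0(3) A1(3) .
qed

section \<open>Averaging over the sample, restriction and exhaustion\<close>

lemma continuous_cap_shear: "continuous_on UNIV (cap_shear t)"
proof -
  have "cap_shear t = (\<lambda>z. (z $ 1 + t * (max (z $ 2 - 1) 0 - max (- z $ 2 - 1) 0)) *\<^sub>R axis 1 1 + z $ 2 *\<^sub>R axis 2 1)"
    by (auto simp: fun_eq_iff vec2_eq_iff cap_speed_def axis_def)
  then show ?thesis by (auto intro!: continuous_intros)
qed

lemma cap_shear_image:
  assumes K: "compact K" "emeasure lborel K > 0"
  shows "polar_mean N r (cap_shear t ` K) = (\<integral>\<^sup>+\<omega>. polar_weight N r (\<lambda>i. cap_shear t (\<omega> i)) \<partial>PiM {1..N} (\<lambda>_. uniform_measure lborel K))"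
    and "emeasure lborel (cap_shear t ` K) = emeasure lborel K"
  using polar_mean_image[OF continuous_cap_shear inj_cap_shear K zero_less_one] emeasure_vimage_cap_shear
  by simp_all

text \<open>The pointwise inequality is integrated over the unmoved sample; the moved samples have
  the laws of the moved bodies because the movement preserves area.\<close>

lemma polar_mean_cap_shear:
  assumes K: "compact K" "emeasure lborel K > 0" and N: "N \<ge> 2" and r: "r \<ge> 1"
    and pq: "0 \<le> p" "0 \<le> q" "p + q = 1" "p * t0 + q * t1 = 0"
  shows "polar_mean N r K \<le> ennreal p * polar_mean N r (cap_shear t0 ` K) + ennreal q * polar_mean N r (cap_shear t1 ` K)"
proof -
  let ?P = "PiM {1..N} (\<lambda>_. uniform_measure lborel K)"
  let ?g = "\<lambda>t \<omega>. polar_weight N r (\<lambda>i. cap_shear t (\<omega> i))"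
  have AE: "AE \<omega> in ?P. cap_shear t (\<omega> 1) $ 1 * cap_shear t (\<omega> 2) $ 2 - cap_shear t (\<omega> 1) $ 2 * cap_shear t (\<omega> 2) $ 1 \<noteq> 0" for t
    by (rule AE_independent_pair[OF measurable_cap_shear emeasure_vimage_cap_shear K N])
  have m[measurable]: "?g t \<in> borel_measurable ?P" for t
  proof -
    have "compose {1..N} (cap_shear t) \<in> measurable ?P ?P" unfolding compose_def by measurable
    from measurable_compose[OF this measurable_polar_weight']
    have "(\<lambda>\<omega>. polar_weight N r (compose {1..N} (cap_shear t) \<omega>)) \<in> borel_measurable ?P" .
    moreover have "polar_weight N r (compose {1..N} (cap_shear t) \<omega>) = ?g t \<omega>" for \<omega>
      by (rule polar_weight_cong) (simp add: compose_def)
    ultimately show ?thesis by simp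
  qed
  have "polar_mean N r K \<le> (\<integral>\<^sup>+\<omega>. ennreal p * ?g t0 \<omega> + ennreal q * ?g t1 \<omega> \<partial>?P)"
    unfolding polar_mean_def
    by (rule nn_integral_mono_AE) (use AE[of t0] AE[of t1] in eventually_elim, rule polar_weight_convex[OF N r pq])
  also have "\<dots> = ennreal p * (\<integral>\<^sup>+\<omega>. ?g t0 \<omega> \<partial>?P) + ennreal q * (\<integral>\<^sup>+\<omega>. ?g t1 \<omega> \<partial>?P)"
    by (subst nn_integral_add) (measurable, simp add: nn_integral_cmult m)
  finally show ?thesis unfolding cap_shear_image(1)[OF K] .
qed

text \<open>On the event that all points lie in \<open>P\<close>, the law for \<open>K\<close> is
  \<open>(p / k) ^ N\<close> times the law for \<open>P\<close>, with \<open>p\<close> and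
  \<open>k\<close> the areas, and this factor is at most 1. The conditional covers null
  \<open>P\<close>, where the event is null once there is a point.\<close>

lemma polar_mean_restrict_le:
  assumes P: "compact P" "P \<subseteq> K" and K: "compact K" "emeasure lborel K > 0"
  shows "(\<integral>\<^sup>+\<omega>. polar_weight N r \<omega> * indicator (Pi\<^sub>E {1..N} (\<lambda>_. P)) \<omega> \<partial>PiM {1..N} (\<lambda>_. uniform_measure lborel K))
    \<le> (if emeasure lborel P = 0 \<and> N \<ge> 1 then 0 else polar_mean N r P)"
proof -
  let ?u = "\<lambda>K. uniform_measure lborel K :: (real^2) measure"
  let ?I = "{1..N}"
  let ?P = "PiM ?I (\<lambda>_. ?u K)"
  have [measurable]: "P \<in> sets borel" "K \<in> sets borel"
    using P K by (simp_all add: compact_imp_closed borel_closed)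
  have fin: "emeasure lborel K \<noteq> \<infinity>" "emeasure lborel P \<noteq> \<infinity>"
    using K P emeasure_compact_finite by (auto simp: less_top)
  have prob: "prob_space (?u K)"
    using K fin by (auto intro!: prob_space_uniform_measure simp: zero_less_iff_neq_zero)
  interpret uK: prob_space "?u K" by fact
  interpret PK: product_sigma_finite "\<lambda>_. ?u K" ..
  have box: "Pi\<^sub>E ?I (\<lambda>_. P) \<in> sets ?P"
    by (rule sets_PiM_I_finite) simp_all
  show ?thesis
  proof (cases "emeasure lborel P = 0")
    case True
    show ?thesis
    proof (cases "N \<ge> 1")
      case N: True
      have "emeasure ?P (Pi\<^sub>E ?I (\<lambda>_. P)) = (\<Prod>i\<in>?I. emeasure (?u K) P)"
        by (rule PK.emeasure_PiM) simp_all
      also have "\<dots> = 0"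
        using True N P(2) by (simp add: Int_absorb1)
      finally have AE: "AE \<omega> in ?P. \<omega> \<notin> Pi\<^sub>E ?I (\<lambda>_. P)"
        using box by (intro AE_not_in null_setsI) auto
      have "(\<integral>\<^sup>+\<omega>. polar_weight N r \<omega> * indicator (Pi\<^sub>E ?I (\<lambda>_. P)) \<omega> \<partial>?P) = (\<integral>\<^sup>+\<omega>. 0 \<partial>?P)"
        by (rule nn_integral_cong_AE) (use AE in eventually_elim, simp)
      then show ?thesis using True N by simp
    next
      case False
      then have "?I = {}" by simp
      then have "PiM ?I (\<lambda>_. ?u K) = PiM ?I (\<lambda>_. ?u P)" by (intro PiM_cong) auto
      then show ?thesis using False
        by (auto simp: polar_mean_def indicator_def intro!: nn_integral_mono)
    qed
  next
    case False
    then have prob': "prob_space (?u P)"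
      using fin by (intro prob_space_uniform_measure) auto
    interpret uP: prob_space "?u P" by fact
    interpret PP: product_sigma_finite "\<lambda>_. ?u P" ..
    define k where "k = measure lborel K"
    define p where "p = measure lborel P"
    have eK: "emeasure lborel K = ennreal k" and eP: "emeasure lborel P = ennreal p"
      using fin by (simp_all add: k_def p_def emeasure_eq_ennreal_measure)
    have kp: "0 < k" "0 < p" using K(2) False eK eP by (auto simp: zero_less_iff_neq_zero ennreal_eq_0_iff)
    have "emeasure lborel P \<le> emeasure lborel K" using P(2) by (intro emeasure_mono) auto
    then have pk: "p \<le> k" using kp eK eP by simp
    define D where "D = density ?P (\<lambda>\<omega>. ennreal ((k / p) ^ N) * indicator (Pi\<^sub>E ?I (\<lambda>_. P)) \<omega>)"
    have "D = PiM ?I (\<lambda>_. ?u P)"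
    proof (rule PP.PiM_eqI)
      show "sets D = sets (PiM ?I (\<lambda>_. ?u P))"
        unfolding D_def by (simp add: sets_PiM_uniform)
      fix A assume "\<And>i. i \<in> ?I \<Longrightarrow> A i \<in> sets (?u P)"
      then have A: "\<And>i. i \<in> ?I \<Longrightarrow> A i \<in> sets borel" by simp
      have mA: "Pi\<^sub>E ?I A \<in> sets ?P" by (rule sets_PiM_I_finite) (use A in simp_all)
      have mAP: "Pi\<^sub>E ?I (\<lambda>i. A i \<inter> P) \<in> sets ?P" by (rule sets_PiM_I_finite) (use A in simp_all)
      have "emeasure D (Pi\<^sub>E ?I A) = (\<integral>\<^sup>+\<omega>. ennreal ((k / p) ^ N) * indicator (Pi\<^sub>E ?I (\<lambda>i. A i \<inter> P)) \<omega> \<partial>?P)"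
        unfolding D_def using mA box
        by (subst emeasure_density) (auto intro!: nn_integral_cong simp: indicator_def PiE_iff)
      also have "\<dots> = ennreal ((k / p) ^ N) * emeasure ?P (Pi\<^sub>E ?I (\<lambda>i. A i \<inter> P))"
        using mAP by (simp add: nn_integral_cmult)
      also have "emeasure ?P (Pi\<^sub>E ?I (\<lambda>i. A i \<inter> P)) = (\<Prod>i\<in>?I. emeasure (?u K) (A i \<inter> P))"
        by (rule PK.emeasure_PiM) (use A in simp_all)
      also have "ennreal ((k / p) ^ N) * \<dots> = (\<Prod>i\<in>?I. ennreal (k / p) * emeasure (?u K) (A i \<inter> P))"
        using kp by (simp add: prod.distrib ennreal_power)
      also have "\<dots> = (\<Prod>i\<in>?I. emeasure (?u P) (A i))"
      proof (rule prod.cong[OF refl])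
        fix i assume i: "i \<in> ?I"
        have m: "A i \<in> sets borel" using A[OF i] .
        define x where "x = measure lborel (A i \<inter> P)"
        have "emeasure lborel (A i \<inter> P) \<le> emeasure lborel P" using m by (intro emeasure_mono) auto
        then have "emeasure lborel (A i \<inter> P) \<noteq> \<top>" using fin(2) by (auto simp: top_unique)
        then have x: "emeasure lborel (A i \<inter> P) = ennreal x"
          unfolding x_def by (rule emeasure_eq_ennreal_measure)
        have x0: "x \<ge> 0" by (simp add: x_def)
        have "K \<inter> (A i \<inter> P) = A i \<inter> P" "P \<inter> A i = A i \<inter> P" using P(2) by auto
        then show "ennreal (k / p) * emeasure (?u K) (A i \<inter> P) = emeasure (?u P) (A i)"
          using m kp x0 by (simp add: eK eP x divide_ennreal ennreal_mult[symmetric])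
      qed
      finally show "emeasure D (Pi\<^sub>E ?I A) = (\<Prod>i\<in>?I. emeasure (?u P) (A i))" .
    qed simp
    then have "polar_mean N r P = (\<integral>\<^sup>+\<omega>. polar_weight N r \<omega> \<partial>D)"
      by (simp add: polar_mean_def)
    also have "\<dots> = (\<integral>\<^sup>+\<omega>. ennreal ((k / p) ^ N) * indicator (Pi\<^sub>E ?I (\<lambda>_. P)) \<omega> * polar_weight N r \<omega> \<partial>?P)"
      unfolding D_def using box by (intro nn_integral_density) simp_all
    also have "\<dots> \<ge> (\<integral>\<^sup>+\<omega>. polar_weight N r \<omega> * indicator (Pi\<^sub>E ?I (\<lambda>_. P)) \<omega> \<partial>?P)"
    proof (rule nn_integral_mono)
      fix \<omega>
      have "1 \<le> (k / p) ^ N" using kp pk by (intro one_le_power) simp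
      then have "1 \<le> ennreal ((k / p) ^ N)" by simp
      from mult_right_mono[OF this, of "polar_weight N r \<omega>"]
      show "polar_weight N r \<omega> * indicator (Pi\<^sub>E ?I (\<lambda>_. P)) \<omega>
        \<le> ennreal ((k / p) ^ N) * indicator (Pi\<^sub>E ?I (\<lambda>_. P)) \<omega> * polar_weight N r \<omega>"
        by (auto simp: indicator_def)
    qed
    finally show ?thesis using False by simp
  qed
qed

text \<open>Almost surely each of the finitely many points lies in some \<open>P n\<close>, hence
  all of them in a common one, so the restricted integrands increase to the full one and monotone
  convergence applies.\<close>

lemma polar_mean_le_of_exhaustion:
  assumes K: "compact K" "emeasure lborel K > 0" and N: "N \<ge> 1"
    and P: "\<And>n. compact (P n)" "\<And>n. P n \<subseteq> K" "incseq P"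
    and cover: "AE x in lborel. x \<in> K \<longrightarrow> (\<exists>n. x \<in> P n)"
    and bound: "\<And>n. emeasure lborel (P n) > 0 \<Longrightarrow> polar_mean N r (P n) \<le> B"
  shows "polar_mean N r K \<le> B"
proof -
  let ?u = "\<lambda>K. uniform_measure lborel K :: (real^2) measure"
  let ?I = "{1..N}"
  let ?P = "PiM ?I (\<lambda>_. ?u K)"
  define E where "E = (\<lambda>n. Pi\<^sub>E ?I (\<lambda>_. P n))"
  have [measurable]: "P n \<in> sets borel" "K \<in> sets borel" for n
    using P K by (simp_all add: compact_imp_closed borel_closed)
  have fin: "emeasure lborel K \<noteq> \<infinity>"
    using K emeasure_compact_finite by (auto simp: less_top)
  have prob: "prob_space (?u K)"
    using K fin by (auto intro!: prob_space_uniform_measure simp: zero_less_iff_neq_zero)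
  have E[measurable]: "E n \<in> sets ?P" for n
    unfolding E_def by (rule sets_PiM_I_finite) simp_all
  have "AE x in ?u K. \<exists>n. x \<in> P n"
    by (rule AE_uniform_measureI) (use cover in auto)
  then have "AE \<omega> in ?P. \<forall>i\<in>?I. \<exists>n. \<omega> i \<in> P n"
    using prob by (intro AE_finite_allI AE_PiM_component) auto
  then have sup: "AE \<omega> in ?P. polar_weight N r \<omega> = (SUP n. polar_weight N r \<omega> * indicator (E n) \<omega>)"
  proof (rule AE_mp, intro AE_I2 impI)
    fix \<omega> assume sp: "\<omega> \<in> space ?P" and "\<forall>i\<in>?I. \<exists>n. \<omega> i \<in> P n"
    then obtain m where m: "\<And>i. i \<in> ?I \<Longrightarrow> \<omega> i \<in> P (m i)" by metis
    define n where "n = Max (m ` ?I)"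
    have "\<omega> i \<in> P n" if "i \<in> ?I" for i
    proof -
      have "m i \<le> n" unfolding n_def using that by (intro Max_ge) auto
      then show ?thesis using m[OF that] \<open>incseq P\<close> by (auto simp: incseq_def)
    qed
    moreover have "\<omega> \<in> extensional ?I" using sp by (auto simp: space_PiM PiE_def)
    ultimately have "\<omega> \<in> E n" by (auto simp: E_def PiE_def)
    then have "polar_weight N r \<omega> \<le> (SUP n. polar_weight N r \<omega> * indicator (E n) \<omega>)"
      by (intro SUP_upper2[of n]) auto
    moreover have "(SUP n. polar_weight N r \<omega> * indicator (E n) \<omega>) \<le> polar_weight N r \<omega>"
      by (intro SUP_least) (auto simp: indicator_def)
    ultimately show "polar_weight N r \<omega> = (SUP n. polar_weight N r \<omega> * indicator (E n) \<omega>)" by simp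
  qed
  have inc: "incseq (\<lambda>n \<omega>. polar_weight N r \<omega> * indicator (E n) \<omega>)"
  proof (intro incseq_SucI le_funI mult_left_mono)
    fix n \<omega>
    have "P n \<subseteq> P (Suc n)" using \<open>incseq P\<close> by (simp add: incseq_SucD)
    then have "E n \<subseteq> E (Suc n)" unfolding E_def by (intro PiE_mono) auto
    then show "indicator (E n) \<omega> \<le> (indicator (E (Suc n)) \<omega> :: ennreal)"
      by (auto simp: indicator_def)
  qed simp
  have "polar_mean N r K = (\<integral>\<^sup>+\<omega>. (SUP n. polar_weight N r \<omega> * indicator (E n) \<omega>) \<partial>?P)"
    unfolding polar_mean_def using sup by (rule nn_integral_cong_AE)
  also have "\<dots> = (SUP n. \<integral>\<^sup>+\<omega>. polar_weight N r \<omega> * indicator (E n) \<omega> \<partial>?P)"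
    by (rule nn_integral_monotone_convergence_SUP[OF inc]) simp
  also have "\<dots> \<le> B"
  proof (rule SUP_least)
    fix n
    have "(\<integral>\<^sup>+\<omega>. polar_weight N r \<omega> * indicator (E n) \<omega> \<partial>?P) \<le> (if emeasure lborel (P n) = 0 \<and> N \<ge> 1 then 0 else polar_mean N r (P n))"
      unfolding E_def by (rule polar_mean_restrict_le[OF P(1,2) K])
    also have "\<dots> \<le> B"
      using N bound[of n] by (auto simp: zero_less_iff_neq_zero)
    finally show "(\<integral>\<^sup>+\<omega>. polar_weight N r \<omega> * indicator (E n) \<omega> \<partial>?P) \<le> B" .
  qed
  finally show ?thesis .
qed

subsection \<open>Polygons, convex bodies and the square\<close>

abbreviation "unit_square \<equiv> cbox (vector [-1, -1]) (vector [1, 1]) :: (real^2) set"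

lemma mem_unit_square: "x \<in> unit_square \<longleftrightarrow> \<bar>x $ 1\<bar> \<le> 1 \<and> \<bar>x $ 2\<bar> \<le> 1"
  by (auto simp: mem_box_cart forall_2)

lemma emeasure_pos_of_interior:
  fixes S :: "'a::euclidean_space set"
  assumes "S \<in> sets borel" "interior S \<noteq> {}"
  shows "emeasure lborel S > 0"
proof -
  obtain x e where e: "e > 0" "ball x e \<subseteq> S" using assms(2) by (auto simp: mem_interior)
  have "0 < measure lborel (ball x e)" using e(1) by (rule content_ball_pos)
  then have "0 < emeasure lborel (ball x e)"
    by (metis measure_eq_0_null_sets less_irrefl null_setsI zero_less_iff_neq_zero sets_lborel borel_open open_ball)
  also have "\<dots> \<le> emeasure lborel S" using e(2) assms(1) by (intro emeasure_mono) auto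
  finally show ?thesis .
qed

lemma unit_square_pos: "emeasure lborel unit_square > 0" "measure lborel unit_square > 0"
proof -
  have "0 \<in> box (vector [-1, -1]) (vector [1, 1] :: real^2)" by (simp add: mem_box_cart forall_2)
  then have "interior unit_square \<noteq> {}" by (auto simp: interior_cbox)
  then show pos: "emeasure lborel unit_square > 0" by (intro emeasure_pos_of_interior) auto
  have "emeasure lborel unit_square \<noteq> \<infinity>" using emeasure_compact_finite[of unit_square] by auto
  then show "measure lborel unit_square > 0"
    using pos by (simp add: emeasure_eq_ennreal_measure)
qed

text \<open>Mean and \<open>r\<close>-th power of the area scale alike under linear maps, so this
  quotient takes the same value on every parallelogram centred at the origin. A bound by it survives
  changes of coordinates.\<close>

definition square_const :: "nat \<Rightarrow> real \<Rightarrow> ennreal" where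
  "square_const N r = polar_mean N r unit_square / ennreal (measure lborel unit_square powr r)"

definition square_bounded :: "nat \<Rightarrow> real \<Rightarrow> (real^2) set \<Rightarrow> bool" where
  "square_bounded N r K \<longleftrightarrow> polar_mean N r K \<le> ennreal (measure lborel K powr r) * square_const N r"

lemma polar_mean_square_image:
  assumes f: "linear f" "inj f"
  shows "polar_mean N r (f ` unit_square) = ennreal (measure lborel (f ` unit_square) powr r) * square_const N r"
proof -
  obtain d where d: "d > 0" "polar_mean N r (f ` unit_square) = ennreal (d powr r) * polar_mean N r unit_square"
    "measure lborel (f ` unit_square) = d * measure lborel unit_square"
    using polar_mean_linear_image[OF f compact_cbox unit_square_pos(1)] by metis
  have "ennreal (measure lborel unit_square powr r) * square_const N r = polar_mean N r unit_square"
    using unit_square_pos(2) unfolding square_const_def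
    by (simp add: ennreal_times_divide mult_divide_eq_ennreal mult.commute[of "ennreal _" "polar_mean N r unit_square"])
  then show ?thesis
    using d unit_square_pos(2) by (simp add: powr_mult ennreal_mult mult.assoc)
qed

lemma square_bounded_linear_image:
  assumes f: "linear f" "inj f" and K: "compact K" "emeasure lborel K > 0"
    and "square_bounded N r (f ` K)"
  shows "square_bounded N r K"
proof -
  obtain d where d: "d > 0" "polar_mean N r (f ` K) = ennreal (d powr r) * polar_mean N r K"
    "measure lborel (f ` K) = d * measure lborel K"
    using polar_mean_linear_image[OF f K] by metis
  have "ennreal (d powr r) * polar_mean N r K \<le> ennreal (d powr r) * (ennreal (measure lborel K powr r) * square_const N r)"
    using assms(5) unfolding square_bounded_def d using d(1) by (simp add: powr_mult ennreal_mult mult.assoc)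
  then show ?thesis
    unfolding square_bounded_def using d(1) by (subst (asm) ennreal_mult_le_mult_iff) auto
qed

text \<open>The linear map that sends \<open>(1, 1)\<close> to \<open>p\<close> and
  \<open>(1, -1)\<close> to \<open>q\<close>, hence the corners of the unit square to
  \<open>p\<close>, \<open>q\<close> and their negatives.\<close>

definition diamond_map :: "real^2 \<Rightarrow> real^2 \<Rightarrow> real^2 \<Rightarrow> real^2" where
  "diamond_map p q x = ((x $ 1 + x $ 2) / 2) *\<^sub>R p + ((x $ 1 - x $ 2) / 2) *\<^sub>R q"

lemma linear_diamond_map: "linear (diamond_map p q)"
  by (rule linearI) (simp_all add: diamond_map_def vec2_eq_iff field_simps)

lemma inj_diamond_map:
  assumes "p $ 1 * q $ 2 - p $ 2 * q $ 1 \<noteq> 0"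
  shows "inj (diamond_map p q)"
proof -
  have "x = 0" if "diamond_map p q x = 0" for x
  proof -
    define s t where "s = (x $ 1 + x $ 2) / 2" and "t = (x $ 1 - x $ 2) / 2"
    have e: "s * p $ 1 + t * q $ 1 = 0" "s * p $ 2 + t * q $ 2 = 0"
      using that by (simp_all add: diamond_map_def vec2_eq_iff s_def t_def)
    have "s * (p $ 1 * q $ 2 - p $ 2 * q $ 1) = q $ 2 * (s * p $ 1 + t * q $ 1) - q $ 1 * (s * p $ 2 + t * q $ 2)"
      "t * (p $ 1 * q $ 2 - p $ 2 * q $ 1) = p $ 1 * (s * p $ 2 + t * q $ 2) - p $ 2 * (s * p $ 1 + t * q $ 1)"
      by (simp_all add: algebra_simps)
    then have "s = 0" "t = 0" using assms unfolding e by auto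
    then show "x = 0" by (simp add: s_def t_def vec2_eq_iff)
  qed
  then show ?thesis by (simp add: linear_injective_0[OF linear_diamond_map])
qed

lemma diamond_map_unit_square: "diamond_map p q ` unit_square = convex hull {p, - p, q, - q}" (is "?L = ?R")
proof
  have C: "p \<in> ?R" "- p \<in> ?R" "q \<in> ?R" "- q \<in> ?R" by (auto intro: hull_inc)
  show "?L \<subseteq> ?R"
  proof (intro image_subsetI)
    fix x :: "real^2" assume "x \<in> unit_square"
    then have x: "\<bar>x $ 1\<bar> \<le> 1" "\<bar>x $ 2\<bar> \<le> 1" by (simp_all add: mem_unit_square)
    \<comment> \<open>The images of \<open>(x $ 1, 1)\<close> and \<open>(x $ 1, -1)\<close>, on two
      opposite edges of the parallelogram; the image of \<open>x\<close> lies between them.\<close>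
    define a where "a = ((1 + x $ 1) / 2) *\<^sub>R p + ((1 - x $ 1) / 2) *\<^sub>R (- q)"
    define b where "b = ((1 - x $ 1) / 2) *\<^sub>R (- p) + ((1 + x $ 1) / 2) *\<^sub>R q"
    have "a \<in> ?R"
      unfolding a_def by (rule convexD[OF convex_convex_hull C(1,4)]) (use x in \<open>auto simp: field_simps\<close>)
    moreover have "b \<in> ?R"
      unfolding b_def by (rule convexD[OF convex_convex_hull C(2,3)]) (use x in \<open>auto simp: field_simps\<close>)
    ultimately have "((1 + x $ 2) / 2) *\<^sub>R a + ((1 - x $ 2) / 2) *\<^sub>R b \<in> ?R"
      by (rule convexD[OF convex_convex_hull]) (use x in \<open>auto simp: field_simps\<close>)
    also have "((1 + x $ 2) / 2) *\<^sub>R a + ((1 - x $ 2) / 2) *\<^sub>R b = diamond_map p q x"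
      by (simp add: a_def b_def diamond_map_def vec2_eq_iff field_simps)
    finally show "diamond_map p q x \<in> ?R" .
  qed
  have "{p, - p, q, - q} \<subseteq> ?L"
  proof -
    have "diamond_map p q (vector [1, 1]) = p" "diamond_map p q (vector [-1, -1]) = - p"
      "diamond_map p q (vector [1, -1]) = q" "diamond_map p q (vector [-1, 1]) = - q"
      by (simp_all add: diamond_map_def vec2_eq_iff)
    moreover have "vector [1, 1] \<in> unit_square" "vector [-1, -1] \<in> unit_square"
      "vector [1, -1] \<in> unit_square" "vector [-1, 1] \<in> unit_square"
      by (simp_all add: mem_unit_square)
    ultimately show ?thesis by (metis empty_subsetI image_eqI insert_subsetI)
  qed
  then show "?R \<subseteq> ?L"
    by (rule hull_minimal) (intro convex_linear_image linear_diamond_map convex_box)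
qed

section \<open>Induction on the number of generating points\<close>

lemma independent_pair_of_pos:
  fixes V :: "(real^2) set"
  assumes "emeasure lborel (convex hull V) > 0"
  obtains p q where "p \<in> V" "q \<in> V" "p $ 1 * q $ 2 - p $ 2 * q $ 1 \<noteq> (0 :: real)"
proof (rule ccontr)
  assume "\<not> thesis"
  then have dep: "p $ 1 * q $ 2 - p $ 2 * q $ 1 = 0" if "p \<in> V" "q \<in> V" for p q
    using that \<open>\<And>p q. p \<in> V \<Longrightarrow> q \<in> V \<Longrightarrow> p $ 1 * q $ 2 - p $ 2 * q $ 1 \<noteq> 0 \<Longrightarrow> thesis\<close> by blast
  \<comment> \<open>If all pairs in \<open>V\<close> are dependent, then \<open>V\<close> lies on
    one line through the origin; when it has no nonzero point, any direction serves.\<close>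
  obtain v :: "real^2" where v: "v \<noteq> 0" "\<And>p. p \<in> V \<Longrightarrow> p $ 1 * v $ 2 - p $ 2 * v $ 1 = 0"
  proof (cases "V \<subseteq> {0}")
    case True
    have "(vector [1, 0] :: real^2) \<noteq> 0" by (simp add: vec2_eq_iff)
    then show ?thesis using True by (intro that[of "vector [1, 0]"]) auto
  next
    case False
    then obtain v where "v \<in> V" "v \<noteq> 0" by auto
    then show ?thesis using dep by (intro that[of v]) auto
  qed
  let ?L = "{x :: real^2. x $ 1 * v $ 2 - x $ 2 * v $ 1 = 0}"
  have "?L = {x. vector [v $ 2, - (v $ 1)] \<bullet> x = 0}"
    by (auto simp: inner_vec_def sum_2 algebra_simps)
  then have "convex ?L" by (simp add: convex_hyperplane)
  then have "convex hull V \<subseteq> ?L" using v(2) by (intro hull_minimal) auto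
  moreover have "?L \<in> sets borel" by measurable
  ultimately have "emeasure lborel (convex hull V) \<le> emeasure lborel ?L" by (intro emeasure_mono) auto
  then show False using planar_line_null[OF v(1)] assms by simp
qed

text \<open>The movement runs in both directions until a vertex is lost. Both end bodies have the
  area of \<open>K\<close> and fewer generators, so the induction hypothesis bounds both means by
  the same number, and convexity in time transfers that bound to time 0.\<close>

lemma square_bounded_cap_polygon:
  assumes "cap_polygon V" and pos: "emeasure lborel (convex hull V) > 0" and N: "N \<ge> 2" and r: "r \<ge> 1"
    and IH: "\<And>W. finite W \<Longrightarrow> card W < card V \<Longrightarrow> (\<And>z. z \<in> convex hull W \<Longrightarrow> - z \<in> convex hull W) \<Longrightarrow>
      emeasure lborel (convex hull W) > 0 \<Longrightarrow> square_bounded N r (convex hull W)"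
  shows "square_bounded N r (convex hull V)"
proof -
  interpret cap_polygon V by fact
  have cpt: "compact K" using fin by (rule finite_imp_compact_convex_hull)
  have step: "polar_mean N r (cap_shear t ` K) \<le> ennreal (measure lborel K powr r) * square_const N r"
    if W: "finite W" "card W < card V" "cap_shear t ` K = convex hull W" for t W
  proof -
    have e: "emeasure lborel (convex hull W) = emeasure lborel K"
      using cap_shear_image(2)[OF cpt pos, of t] W(3) by simp
    have "- z \<in> convex hull W" if z: "z \<in> convex hull W" for z
    proof -
      obtain y where "y \<in> K" "z = cap_shear t y" using z unfolding W(3)[symmetric] by auto
      then have "- z = cap_shear t (- y)" "- y \<in> K" using sym by (simp_all add: cap_shear_minus)
      then show ?thesis unfolding W(3)[symmetric] by blast
    qed
    then have "square_bounded N r (convex hull W)" using IH[OF W(1,2)] pos e by simp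
    then show ?thesis unfolding square_bounded_def W(3) by (simp add: measure_def e)
  qed
  obtain t1 W1 where 1: "t1 \<ge> 0" "finite W1" "card W1 < card V" "cap_shear t1 ` K = convex hull W1"
    using drop_vertex by blast
  obtain t0 W0 where 0: "t0 \<ge> 0" "finite W0" "card W0 < card V" "cap_shear (- t0) ` K = convex hull W0"
    using drop_vertex_neg by blast
  \<comment> \<open>The weights make time 0 the mean of \<open>- t0\<close> and \<open>t1\<close>.
    If both times are 0, \<open>K\<close> is itself a hull of fewer points and any weights would
    do.\<close>
  obtain p q where pq: "0 \<le> p" "0 \<le> q" "p + q = 1" "p * (- t0) + q * t1 = 0"
  proof (cases "t0 + t1 = 0")
    case True
    then show ?thesis using 0 1 by (intro that[of 1 0]) auto
  next
    case False
    then have "t0 + t1 > 0" using 0 1 by simp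
    then show ?thesis using 0 1
      by (intro that[of "t1 / (t0 + t1)" "t0 / (t0 + t1)"]) (auto simp: add_divide_distrib[symmetric] add.commute)
  qed
  let ?B = "ennreal (measure lborel K powr r) * square_const N r"
  have "polar_mean N r K \<le> ennreal p * polar_mean N r (cap_shear (- t0) ` K) + ennreal q * polar_mean N r (cap_shear t1 ` K)"
    by (rule polar_mean_cap_shear[OF cpt pos N r pq])
  also have "\<dots> \<le> ennreal p * ?B + ennreal q * ?B"
    using step[OF 0(2-4)] step[OF 1(2-4)] by (intro add_mono mult_left_mono) auto
  also have "\<dots> = ennreal (p + q) * ?B" by (simp only: ennreal_plus[OF pq(1,2)] distrib_right)
  also have "\<dots> = ?B" using pq by simp
  finally show ?thesis by (simp add: square_bounded_def)
qed

text \<open>A generator that is not extreme is deleted. If all are extreme, two independent vertices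
  and their negatives either exhaust \<open>V\<close>, giving a parallelogram with equality, or a
  further vertex lies beyond a chord and a cap movement reduces the number of generators.\<close>

lemma square_bounded_polygon:
  assumes "finite V" "\<And>z. z \<in> convex hull V \<Longrightarrow> - z \<in> convex hull V" "emeasure lborel (convex hull V) > 0"
    and N: "N \<ge> 2" and r: "r \<ge> 1"
  shows "square_bounded N r (convex hull V)"
  using assms(1-3)
proof (induction "card V" arbitrary: V rule: less_induct)
  case less
  note fin = less.prems(1) and sym = less.prems(2) and pos = less.prems(3)
  let ?K = "convex hull V"
  have cpt: "compact ?K" using fin by (rule finite_imp_compact_convex_hull)
  show ?case
  proof (cases "\<forall>v\<in>V. v extreme_point_of ?K")
    case False
    then obtain v where v: "v \<in> V" "\<not> v extreme_point_of ?K" by blast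
    have ins: "insert v (V - {v}) = V" using v by auto
    have "v \<in> convex hull (V - {v})"
      using extreme_point_of_convex_hull_insert[of "V - {v}" v] fin v unfolding ins by auto
    then have eq: "?K = convex hull (V - {v})"
      using hull_redundant[of v convex "V - {v}"] unfolding ins by simp
    have "card (V - {v}) < card V" using fin v by (intro card_Diff1_less)
    then show ?thesis
      using less.hyps[of "V - {v}"] fin sym pos unfolding eq by simp
  next
    case ext: True
    have symV: "- v \<in> V" if "v \<in> V" for v
      using extreme_point_of_convex_hull[OF extreme_point_of_uminus[OF sym bspec[OF ext that]]] .
    obtain p1 p2 where p12: "p1 \<in> V" "p2 \<in> V" "p1 $ 1 * p2 $ 2 - p1 $ 2 * p2 $ 1 \<noteq> 0"
      using independent_pair_of_pos[OF pos] by blast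
    show ?thesis
    proof (cases "V \<subseteq> {p1, - p1, p2, - p2}")
      case True
      then have "V = {p1, - p1, p2, - p2}" using p12 symV by auto
      then have "?K = diamond_map p1 p2 ` unit_square" by (simp add: diamond_map_unit_square)
      then show ?thesis
        unfolding square_bounded_def
        using polar_mean_square_image[OF linear_diamond_map inj_diamond_map[OF p12(3)]] by simp
    next
      case False
      then obtain p3 where p3: "p3 \<in> V" "p3 \<notin> {p1, - p1, p2, - p2}" by blast
      define D where "D = p1 $ 1 * p2 $ 2 - p1 $ 2 * p2 $ 1"
      have D: "D \<noteq> 0" using p12(3) by (simp add: D_def)
      \<comment> \<open>Cramer's rule for the coordinates of \<open>p3\<close> in the basis
        \<open>p1\<close>, \<open>p2\<close>; the signs chosen next put \<open>p3\<close> into the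
        cone spanned by \<open>q1\<close> and \<open>q2\<close>.\<close>
      define \<alpha> where "\<alpha> = (p3 $ 1 * p2 $ 2 - p3 $ 2 * p2 $ 1) / D"
      define \<beta> where "\<beta> = (p1 $ 1 * p3 $ 2 - p1 $ 2 * p3 $ 1) / D"
      have "D *\<^sub>R p3 = (D * \<alpha>) *\<^sub>R p1 + (D * \<beta>) *\<^sub>R p2"
        using D by (simp add: \<alpha>_def \<beta>_def vec2_eq_iff) (simp add: D_def algebra_simps)
      then have "D *\<^sub>R p3 = D *\<^sub>R (\<alpha> *\<^sub>R p1 + \<beta> *\<^sub>R p2)" by (simp add: scaleR_right_distrib)
      then have p3e: "p3 = \<alpha> *\<^sub>R p1 + \<beta> *\<^sub>R p2" using D by (simp only: real_vector.scale_cancel_left) simp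
      define q1 where "q1 = (if \<alpha> \<ge> 0 then p1 else - p1)"
      define q2 where "q2 = (if \<beta> \<ge> 0 then p2 else - p2)"
      have q: "q1 \<in> V" "q2 \<in> V" "q1 $ 1 * q2 $ 2 - q1 $ 2 * q2 $ 1 \<noteq> 0"
        "p3 \<notin> {q1, - q1, q2, - q2}" "p3 = \<bar>\<alpha>\<bar> *\<^sub>R q1 + \<bar>\<beta>\<bar> *\<^sub>R q2"
        using p12 symV p3(2) p3e by (auto simp: q1_def q2_def)
      \<comment> \<open>A coordinate sum of at most 1 would put \<open>p3\<close> into the
        parallelogram spanned by \<open>q1\<close>, \<open>q2\<close> and their negatives, where an
        extreme point must be one of these four.\<close>
      have gt: "\<bar>\<alpha>\<bar> + \<bar>\<beta>\<bar> > 1"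
      proof (rule ccontr)
        assume "\<not> \<bar>\<alpha>\<bar> + \<bar>\<beta>\<bar> > 1"
        then have "vector [\<bar>\<alpha>\<bar> + \<bar>\<beta>\<bar>, \<bar>\<alpha>\<bar> - \<bar>\<beta>\<bar>] \<in> unit_square" by (auto simp: mem_unit_square)
        then have "diamond_map q1 q2 (vector [\<bar>\<alpha>\<bar> + \<bar>\<beta>\<bar>, \<bar>\<alpha>\<bar> - \<bar>\<beta>\<bar>]) \<in> convex hull {q1, - q1, q2, - q2}"
          unfolding diamond_map_unit_square[symmetric] by (rule imageI)
        then have in4: "p3 \<in> convex hull {q1, - q1, q2, - q2}"
          by (simp add: diamond_map_def flip: q(5))
        have "{q1, - q1, q2, - q2} \<subseteq> V" using q symV by auto
        then have "convex hull {q1, - q1, q2, - q2} \<subseteq> ?K" by (rule hull_mono)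
        then have "p3 extreme_point_of (convex hull {q1, - q1, q2, - q2})"
          using bspec[OF ext p3(1)] in4 unfolding extreme_point_of_def by blast
        then show False using extreme_point_of_convex_hull q(4) by blast
      qed
      \<comment> \<open>The minus sign makes \<open>h\<close> send \<open>(-1, 1)\<close> to
        \<open>q2\<close>. In the new coordinates \<open>p3\<close> has height
        \<open>\<bar>\<alpha>\<bar> + \<bar>\<beta>\<bar>\<close>, so by \<open>gt\<close> it lies
        above the chord.\<close>
      define h where "h = diamond_map q1 (- q2)"
      have h: "linear h" "inj h"
        unfolding h_def using q(3) by (auto intro!: linear_diamond_map inj_diamond_map)
      obtain g where g: "linear g" "g \<circ> h = id" "h \<circ> g = id"
        using linear_injective_isomorphism[OF h] by (auto simp: fun_eq_iff)
      have gh: "g (h x) = x" and hg: "h (g x) = x" for x using g(2,3) by (simp_all add: fun_eq_iff)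
      have injg: "inj g" by (metis hg injI)
      have "h (vector [1, 1]) = q1" "h (vector [-1, 1]) = q2"
        by (simp_all add: h_def diamond_map_def)
      then have gq: "g q1 = vector [1, 1]" "g q2 = vector [-1, 1]" using gh by metis+
      have gK: "g ` ?K = convex hull (g ` V)" by (rule convex_hull_linear_image[OF g(1)])
      have poly: "cap_polygon (g ` V)"
      proof
        show "finite (g ` V)" using fin by simp
        show "- z \<in> convex hull (g ` V)" if "z \<in> convex hull (g ` V)" for z
        proof -
          obtain y where "y \<in> ?K" "z = g y" using \<open>z \<in> convex hull (g ` V)\<close> unfolding gK[symmetric] by auto
          then have "- z = g (- y)" "- y \<in> ?K" using sym linear_neg[OF g(1)] by simp_all
          then show ?thesis unfolding gK[symmetric] by blast
        qed
        show "vector [1, 1] extreme_point_of convex hull (g ` V)"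
          unfolding gK[symmetric] gq[symmetric]
          by (rule extreme_point_of_linear_inj[OF g(1) injg bspec[OF ext q(1)]])
        show "vector [-1, 1] extreme_point_of convex hull (g ` V)"
          unfolding gK[symmetric] gq[symmetric]
          by (rule extreme_point_of_linear_inj[OF g(1) injg bspec[OF ext q(2)]])
        have "g p3 = \<bar>\<alpha>\<bar> *\<^sub>R vector [1, 1] + \<bar>\<beta>\<bar> *\<^sub>R vector [-1, 1]"
          by (subst q(5)) (simp only: linear_add[OF g(1)] linear_scale[OF g(1)] gq)
        then have "g p3 $ 2 > 1" using gt by simp
        then show "\<exists>b\<in>g ` V. 1 < b $ 2" using p3(1) by blast
      qed
      have posg: "emeasure lborel (convex hull (g ` V)) > 0"
        using polar_mean_linear_image[OF g(1) injg cpt pos] unfolding gK[symmetric] by blast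
      have card: "card (g ` V) = card V" using injg by (simp add: card_image inj_on_subset[OF injg])
      have "square_bounded N r (convex hull (g ` V))"
      proof (rule square_bounded_cap_polygon[OF poly posg N r])
        fix W :: "(real^2) set"
        assume "finite W" "card W < card (g ` V)" "\<And>z. z \<in> convex hull W \<Longrightarrow> - z \<in> convex hull W"
          "emeasure lborel (convex hull W) > 0"
        then show "square_bounded N r (convex hull W)" unfolding card by (intro less.hyps)
      qed
      then have "square_bounded N r (g ` ?K)" unfolding gK .
      then show ?thesis by (rule square_bounded_linear_image[OF g(1) injg cpt pos])
    qed
  qed
qed

text \<open>Hulls of the first points of a countable dense subset and their negatives are inscribed
  symmetric polygons. Their areas are at most that of \<open>K\<close>, so one bound serves for all
  of them and passes to the limit.\<close>

lemma square_bounded_convex_body: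
  assumes K: "compact K" "convex K" "interior K \<noteq> {}" and sym: "\<And>z. z \<in> K \<Longrightarrow> - z \<in> K"
    and N: "N \<ge> 2" and r: "r \<ge> 1"
  shows "square_bounded N r K"
proof -
  have mK: "K \<in> sets borel" using K by (simp add: compact_imp_closed borel_closed)
  have pos: "emeasure lborel K > 0" by (rule emeasure_pos_of_interior[OF mK K(3)])
  obtain T where T: "countable T" "T \<subseteq> K" "K \<subseteq> closure T" using separable by metis
  have "T \<noteq> {}" using T(3) K(3) interior_subset[of K] by auto
  define d where "d = from_nat_into T"
  have d: "range d = T" unfolding d_def using \<open>T \<noteq> {}\<close> T(1) by (rule range_from_nat_into)
  define V where "V n = d ` {..n} \<union> uminus ` d ` {..n}" for n :: nat
  define P where "P n = convex hull (V n)" for n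
  have finV: "finite (V n)" for n by (simp add: V_def)
  have cptP: "compact (P n)" for n unfolding P_def by (rule finite_imp_compact_convex_hull[OF finV])
  have PK: "P n \<subseteq> K" for n
  proof -
    have "V n \<subseteq> K" using d T(2) sym by (auto simp: V_def)
    then show ?thesis unfolding P_def using K(2) by (rule hull_minimal)
  qed
  have symP: "- z \<in> P n" if "z \<in> P n" for z n
  proof -
    have lin: "linear (uminus :: real^2 \<Rightarrow> _)" by (auto intro!: linearI)
    have "uminus ` V n = V n" by (auto simp: V_def image_Un image_image)
    then have "uminus ` P n = P n" unfolding P_def convex_hull_linear_image[OF lin] by simp
    then show ?thesis using that by blast
  qed
  have incP: "incseq P"
    unfolding incseq_def P_def V_def by (intro allI impI hull_mono Un_mono image_mono) auto
  define U where "U = (\<Union>n. P n)"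
  have "convex U"
    unfolding convex_contains_segment
  proof (intro ballI)
    fix a b assume "a \<in> U" "b \<in> U"
    then obtain m n where "a \<in> P m" "b \<in> P n" by (auto simp: U_def)
    then have "a \<in> P (max m n)" "b \<in> P (max m n)"
      using incseqD[OF incP, of m "max m n"] incseqD[OF incP, of n "max m n"] by auto
    then have "closed_segment a b \<subseteq> P (max m n)"
      unfolding P_def by (intro closed_segment_subset convex_convex_hull)
    then show "closed_segment a b \<subseteq> U" by (auto simp: U_def)
  qed
  have "T \<subseteq> U"
  proof
    fix x assume "x \<in> T"
    then obtain n where "x = d n" using d by auto
    then have "x \<in> P n" unfolding P_def V_def by (intro hull_inc) auto
    then show "x \<in> U" by (auto simp: U_def)
  qed
  then have "K \<subseteq> closure U" using T(3) closure_mono by blast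
  \<comment> \<open>A convex set and its closure have the same interior, so the dense convex set
    \<open>U\<close> misses at most the frontier of \<open>K\<close>, which is null.\<close>
  then have "interior K \<subseteq> interior (closure U)" by (rule interior_mono)
  also have "\<dots> = interior U" using \<open>convex U\<close> by (rule convex_interior_closure)
  finally have intK: "interior K \<subseteq> U" using interior_subset by blast
  have "negligible (frontier K)" using K(2) by (rule negligible_convex_frontier)
  moreover have "frontier K \<in> sets borel" by (simp add: borel_closed)
  ultimately have "frontier K \<in> null_sets lborel"
    by (simp add: negligible_iff_null_sets null_sets_completion_iff)
  from AE_not_in[OF this] have cover: "AE x in lborel. x \<in> K \<longrightarrow> (\<exists>n. x \<in> P n)"
  proof eventually_elim
    case (elim x)
    then show ?case using intK closure_subset[of K] by (auto simp: frontier_def U_def)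
  qed
  have "polar_mean N r K \<le> ennreal (measure lborel K powr r) * square_const N r"
  proof (rule polar_mean_le_of_exhaustion[OF K(1) pos _ cptP PK incP cover])
    show "N \<ge> 1" using N by simp
    fix n assume posP: "emeasure lborel (P n) > 0"
    have "square_bounded N r (P n)"
      unfolding P_def using posP symP finV N r by (intro square_bounded_polygon) (auto simp: P_def)
    then have "polar_mean N r (P n) \<le> ennreal (measure lborel (P n) powr r) * square_const N r"
      by (simp add: square_bounded_def)
    also have "\<dots> \<le> ennreal (measure lborel K powr r) * square_const N r"
    proof (intro mult_right_mono ennreal_leI powr_mono2)
      show "measure lborel (P n) \<le> measure lborel K"
        using PK mK borel_closed[OF compact_imp_closed[OF cptP]] emeasure_compact_finite[OF K(1)]
        by (intro measure_mono_fmeasurable) (auto simp: fmeasurable_def)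
    qed (use r in auto)
    finally show "polar_mean N r (P n) \<le> ennreal (measure lborel K powr r) * square_const N r" .
  qed
  then show ?thesis by (simp add: square_bounded_def)
qed

theorem theorem1p1:
  fixes N :: nat and r :: real
    and K Q :: "(real^2) set"
    and M :: "'w measure" and X :: "nat \<Rightarrow> 'w \<Rightarrow> real^2"
    and M' :: "'v measure" and Y :: "nat \<Rightarrow> 'v \<Rightarrow> real^2"
  assumes "N \<ge> 2" and "r \<ge> 1"
    and "convex_body K" and "centrally_symmetric K"
    and "centered_square Q" and "emeasure lborel Q = emeasure lborel K"
    and "iid_uniform M N X K" and "iid_uniform M' N Y Q"
  shows "expected_polar_power M N r X \<le> expected_polar_power M' N r Y"
proof -
  have K: "compact K" "convex K" "interior K \<noteq> {}" using assms(3) by (auto simp: convex_body_def)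
  have sym: "- z \<in> K" if "z \<in> K" for z
    using assms(4) that unfolding centrally_symmetric_def by (metis image_eqI)
  have "square_bounded N r K"
    using K sym assms(1,2) by (rule square_bounded_convex_body)
  then have le: "polar_mean N r K \<le> ennreal (measure lborel K powr r) * square_const N r"
    by (simp add: square_bounded_def)
  obtain a and f :: "real^2 \<Rightarrow> real^2" where f: "a > 0" "orthogonal_transformation f"
    "Q = f ` cbox (vector [-a, -a]) (vector [a, a])"
    using assms(5) by (auto simp: centered_square_def)
  have box: "cbox (vector [-a, -a]) (vector [a, a]) = (\<lambda>x. a *\<^sub>R x) ` unit_square"
  proof (intro subset_antisym subsetI)
    fix x :: "real^2" assume x: "x \<in> cbox (vector [-a, -a]) (vector [a, a])"
    have "x = a *\<^sub>R ((1 / a) *\<^sub>R x)" using f(1) by simp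
    moreover have "(1 / a) *\<^sub>R x \<in> unit_square"
      using x f(1) by (auto simp: mem_box_cart forall_2 field_simps)
    ultimately show "x \<in> (\<lambda>x. a *\<^sub>R x) ` unit_square" by (rule image_eqI)
  next
    fix x assume "x \<in> (\<lambda>x. a *\<^sub>R x) ` unit_square"
    then obtain y where y: "x = a *\<^sub>R y" "y \<in> unit_square" by (rule imageE)
    then have "\<bar>x $ 1\<bar> \<le> a" "\<bar>x $ 2\<bar> \<le> a" using f(1) by (simp_all add: mem_unit_square abs_mult)
    then show "x \<in> cbox (vector [-a, -a]) (vector [a, a])" by (auto simp: mem_box_cart forall_2)
  qed
  have lin: "linear (\<lambda>x. f (a *\<^sub>R x))"
    using linear_compose[OF linear_scale_self orthogonal_transformation_linear[OF f(2)]] by (simp add: o_def)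
  have inj: "inj (\<lambda>x. f (a *\<^sub>R x))"
  proof (rule injI)
    fix x y assume "f (a *\<^sub>R x) = f (a *\<^sub>R y)"
    then have "a *\<^sub>R x = a *\<^sub>R y" by (rule injD[OF orthogonal_transformation_inj[OF f(2)]])
    then show "x = y" using f(1) by simp
  qed
  \<comment> \<open>As a linear image of the unit square, \<open>Q\<close> attains the bound with
    equality, and equal areas make this the bound for \<open>K\<close>.\<close>
  have "Q = (\<lambda>x. f (a *\<^sub>R x)) ` unit_square" by (simp add: f(3) box image_image)
  then have "polar_mean N r Q = ennreal (measure lborel Q powr r) * square_const N r"
    using polar_mean_square_image[OF lin inj] by simp
  moreover have "measure lborel Q = measure lborel K" using assms(6) by (simp add: measure_def)
  ultimately have "polar_mean N r K \<le> polar_mean N r Q" using le by simp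
  then show ?thesis
    using expected_polar_power_eq[OF assms(7)] expected_polar_power_eq[OF assms(8)] assms(1) by simp
qed

end
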